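(* Let $k\ge 2$, let $\rho\in(0,1)^k$ with $\sum_{i=1}^k\rho_i=1$, let $P\in(0,1)^{k\times k}$ be symmetric, let $t>0$, and let $G\sim \mathrm{CSBM}_n^k(\rho,P,t)$. Let $t_c=\big(\min_{i\ne j}\Delta_+(\theta_i,\theta_j)\big)^{-1}$, where $\theta_i=(\rho_rP_{ri},\ \rho_r(1-P_{ri}))_{r\in[k]}\in\mathbb{R}^{2k}$. If $t<t_c$, then for any estimator $\hat\sigma=\hat\sigma(G)$, $$\lim_{n\to\infty}\mathbb{P}(\hat\sigma\text{ achieves exact recovery})=0.$$
   Context: Censored Stochastic Block Model $\mathrm{CSBM}_n^k(\rho,P,t)$: the parameters $k,\rho,P,t$ are fixed as $n\to\infty$. Each vertex $v\in[n]$ independently receives a community $\sigma_0(v)\in[k]$ with $\mathbb{P}(\sigma_0(v)=i)=\rho_i$. Given $\sigma_0$, each pair $\{u,v\}$ with $u\ne v$ is an edge independently with probability $P_{\sigma_0(u)\sigma_0(v)}$ (no self-loops). Independently, the status of each pair is revealed with probability $\frac{t\log n}{n}$ and censored otherwise. The observed graph $G$ records for each pair one of the statuses present (revealed edge), absent (revealed non-edge), or censored; $\sigma_0$ is not observed. Exact recovery: let $S_0\in\{0,1\}^{n\times k}$ have entries $(S_0)_{ui}=\mathbf 1\{\sigma_0(u)=i\}$, and for an estimator $\hat\sigma:[n]\to[k]$ (a possibly randomized function of $G$; the parameters are known) let $\hat S_{ui}=\mathbf 1\{\hat\sigma(u)=i\}$. The estimator achieves exact recovery if there is a $k\times k$ permutation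 matrix $J$ with $\hat SJ=S_0$. Chernoff–Hellinger divergence: for $\mu,\nu\in(0,\infty)^l$ and $\xi\in[0,1]$, let $\mathrm{CH}_\xi(\mu,\nu)=\sum_{i\in[l]}\big[\xi\mu_i+(1-\xi)\nu_i-\mu_i^{\xi}\nu_i^{1-\xi}\big]$, and $\Delta_+(\mu,\nu)=\max_{\xi\in[0,1]}\mathrm{CH}_\xi(\mu,\nu)$. Convention: $1/0=\infty$. *)

theory Defs
  imports "HOL-Probability.Probability" "HOL-Probability.Product_PMF"
begin

text \<open>
  Communities are the elements of a finite type \<open>'k\<close> and vertices the numbers \<open>1, \<dots>, n\<close>.
  A labelling is a function on all of \<open>nat\<close>, of which only the values on \<open>{1..n}\<close> matter.
\<close>

definition community_pmf :: "real ^ 'k \<Rightarrow> 'k::finite pmf" where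
  "community_pmf \<rho> = embed_pmf (\<lambda>i. \<rho> $ i)"

lemma pmf_community_pmf:
  fixes \<rho> :: "real ^ 'k::finite"
  assumes "\<And>i. 0 \<le> \<rho> $ i" and "(\<Sum>i\<in>UNIV. \<rho> $ i) = 1"
  shows "pmf (community_pmf \<rho>) i = \<rho> $ i"
  unfolding community_pmf_def
  by (rule pmf_embed_pmf) (use assms in \<open>simp_all add: nn_integral_count_space_finite\<close>)

datatype status = Present | Absent | Censored

text \<open>\<open>p\<close> is the edge probability and \<open>q\<close> the probability of being revealed.\<close>

definition status_pmf :: "real \<Rightarrow> real \<Rightarrow> status pmf" where
  "status_pmf p q = do {
     edge \<leftarrow> bernoulli_pmf p;
     revealed \<leftarrow> bernoulli_pmf q;
     return_pmf (if revealed then (if edge then Present else Absent) else Censored)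
   }"

text \<open>
  An unordered pair of distinct vertices is represented by its increasing enumeration, so that
  every pair receives exactly one status.
\<close>

definition vertex_pairs :: "nat \<Rightarrow> (nat \<times> nat) set" where
  "vertex_pairs n = {(u, v). 1 \<le> u \<and> u < v \<and> v \<le> n}"

type_synonym observed_graph = "nat \<times> nat \<Rightarrow> status"

text \<open>
  The joint law of \<open>(\<sigma>\<^sub>0, G)\<close>. The defaults \<open>undefined\<close> and \<open>Censored\<close> are the constant values
  outside \<open>{1..n}\<close> and \<open>vertex_pairs n\<close>. For the finitely many \<open>n\<close> with \<open>t * ln n / n > 1\<close>,
  \<^const>\<open>bernoulli_pmf\<close> truncates the revealing probability to 1.
\<close>

definition CSBM ::
  "nat \<Rightarrow> real ^ 'k \<Rightarrow> real ^ 'k ^ 'k \<Rightarrow> real \<Rightarrow> ((nat \<Rightarrow> 'k::finite) \<times> observed_graph) pmf" where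
  "CSBM n \<rho> P t = do {
     \<sigma>\<^sub>0 \<leftarrow> Pi_pmf {1..n} undefined (\<lambda>_. community_pmf \<rho>);
     G \<leftarrow> Pi_pmf (vertex_pairs n) Censored
            (\<lambda>(u, v). status_pmf (P $ \<sigma>\<^sub>0 u $ \<sigma>\<^sub>0 v) (t * ln (real n) / real n));
     return_pmf (\<sigma>\<^sub>0, G)
   }"

text \<open>
  A randomized function of the graph is a Markov kernel: given \<open>G\<close>, the estimate is drawn from a
  law depending on \<open>G\<close> only (hence conditionally independently of \<open>\<sigma>\<^sub>0\<close>). Deterministic estimators
  are the Dirac kernels.
\<close>

type_synonym 'k estimator = "observed_graph \<Rightarrow> (nat \<Rightarrow> 'k) pmf"

definition truth_estimate_pmf ::
  "((nat \<Rightarrow> 'k) \<times> observed_graph) pmf \<Rightarrow> 'k estimator \<Rightarrow> ((nat \<Rightarrow> 'k) \<times> (nat \<Rightarrow> 'k)) pmf" where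
  "truth_estimate_pmf M est = do {
     (\<sigma>\<^sub>0, G) \<leftarrow> M;
     \<sigma> \<leftarrow> est G;
     return_pmf (\<sigma>\<^sub>0, \<sigma>)
   }"

text \<open>
  The \<open>n \<times> k\<close> membership matrix of \<open>\<sigma>\<close> is given by its rows, so that row \<open>u\<close> of its product with
  a \<open>k \<times> k\<close> matrix \<open>J\<close> is \<open>membership_row \<sigma> u v* J\<close>.
\<close>

definition membership_row :: "(nat \<Rightarrow> 'k) \<Rightarrow> nat \<Rightarrow> real ^ 'k::finite" where
  "membership_row \<sigma> u = (\<chi> i. of_bool (\<sigma> u = i))"

definition permutation_matrix :: "real ^ 'k ^ 'k::finite \<Rightarrow> bool" where
  "permutation_matrix J \<longleftrightarrow> (\<exists>\<pi>. \<pi> permutes UNIV \<and> J = (\<chi> i j. of_bool (j = \<pi> i)))"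

definition exact_recovery :: "nat \<Rightarrow> (nat \<Rightarrow> 'k::finite) \<Rightarrow> (nat \<Rightarrow> 'k) \<Rightarrow> bool" where
  "exact_recovery n \<sigma>\<^sub>0 \<sigma> \<longleftrightarrow>
     (\<exists>J :: real ^ 'k ^ 'k. permutation_matrix J \<and>
        (\<forall>u\<in>{1..n}. membership_row \<sigma> u v* J = membership_row \<sigma>\<^sub>0 u))"

definition CH :: "real \<Rightarrow> real ^ 'l \<Rightarrow> real ^ 'l::finite \<Rightarrow> real" where
  "CH \<xi> \<mu> \<nu> = (\<Sum>i\<in>UNIV. \<xi> * \<mu> $ i + (1 - \<xi>) * \<nu> $ i - (\<mu> $ i) powr \<xi> * (\<nu> $ i) powr (1 - \<xi>))"

definition CH_divergence :: "real ^ 'l \<Rightarrow> real ^ 'l::finite \<Rightarrow> real" where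
  "CH_divergence \<mu> \<nu> = (SUP \<xi>\<in>{0..1}. CH \<xi> \<mu> \<nu>)"

text \<open>The supremum is a maximum, as in the usual definition.\<close>

lemma CH_divergence_attained:
  fixes \<mu> \<nu> :: "real ^ 'l::finite"
  assumes "\<And>i. 0 < \<mu> $ i" and "\<And>i. 0 < \<nu> $ i"
  shows "\<exists>\<xi>\<in>{0..1}. CH_divergence \<mu> \<nu> = CH \<xi> \<mu> \<nu> \<and> (\<forall>\<eta>\<in>{0..1}. CH \<eta> \<mu> \<nu> \<le> CH \<xi> \<mu> \<nu>)"
proof -
  have "continuous_on {0..1} (\<lambda>\<xi>. CH \<xi> \<mu> \<nu>)"
    unfolding CH_def using assms
    by (intro continuous_intros) (auto simp: less_imp_neq[symmetric])
  then obtain \<xi> where \<xi>: "\<xi> \<in> {0..1::real}" "\<forall>\<eta>\<in>{0..1}. CH \<eta> \<mu> \<nu> \<le> CH \<xi> \<mu> \<nu>"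
    using continuous_attains_sup[of "{0..1::real}"] by force
  moreover have "CH_divergence \<mu> \<nu> = CH \<xi> \<mu> \<nu>"
    unfolding CH_divergence_def using \<xi> by (intro cSup_eq_maximum) auto
  ultimately show ?thesis by blast
qed

text \<open>
  The \<open>2k\<close> coordinates are indexed by \<open>'k \<times> bool\<close>: \<open>(r, True)\<close> for edges and \<open>(r, False)\<close> for
  non-edges towards community \<open>r\<close>.
\<close>

definition \<theta> :: "real ^ 'k \<Rightarrow> real ^ 'k ^ 'k \<Rightarrow> 'k::finite \<Rightarrow> real ^ ('k \<times> bool)" where
  "\<theta> \<rho> P i = (\<chi> re. case re of (r, e) \<Rightarrow> if e then \<rho> $ r * P $ r $ i else \<rho> $ r * (1 - P $ r $ i))"

text \<open>In \<^typ>\<open>ereal\<close>, \<open>inverse 0 = \<infinity>\<close>.\<close>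

definition t_crit :: "real ^ 'k \<Rightarrow> real ^ 'k ^ 'k::finite \<Rightarrow> ereal" where
  "t_crit \<rho> P = inverse (ereal (Min {CH_divergence (\<theta> \<rho> P i) (\<theta> \<rho> P j) | i j. i \<noteq> j}))"

end

theory Submission
  imports Defs "HOL-Real_Asymp.Real_Asymp"
begin

text \<open>
  Let \<open>i \<noteq> j\<close> attain the minimal divergence \<open>\<Delta>\<close>, so that \<open>t \<Delta> < 1\<close>. Given the graph, the posterior
  weight of the true labelling \<open>\<sigma>\<close> changes by at most a factor \<open>n\<^sup>\<epsilon>\<close> (up to a constant) when a
  vertex \<open>v\<close> of community \<open>i\<close> is moved to \<open>j\<close>, provided that the log-likelihood ratio of the
  statuses of the pairs at \<open>v\<close> is at most \<open>\<epsilon> ln n\<close> in absolute value. If, with high probability,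
  far more than \<open>n\<^sup>\<epsilon>\<close> vertices have this property, then \<open>\<sigma>\<close> has vanishing posterior
  probability, and so has its orbit under the (boundedly many) permutations of the communities; hence
  no estimator, randomized or not, can recover it.

  To count these vertices, only \<open>v\<close> among the first \<open>m \<approx> n / (ln n)\<^sup>2\<close> vertices are considered, and
  only pairs leading out of this block contribute to the ratio, which makes the events for different
  \<open>v\<close> independent. A vertex has a revealed pair inside the block with probability at most
  \<open>m t ln n / n \<rightarrow> 0\<close>, independently of the ratio, so discarding such vertices is harmless. Each event
  has probability of order at least \<open>n powr (- t \<Delta> - 2 \<epsilon>)\<close> by an exponential change of measure at an interior
  maximiser \<open>\<xi>\<close> of the Chernoff-Hellinger function: there the tilted mean of the ratio vanishes to
  first order and Chebyshev's inequality applies.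
\<close>

subsection \<open>Finitely supported probability mass functions\<close>

lemma prob_bind_pmf_finite:
  assumes "finite (set_pmf M)"
  shows "measure_pmf.prob (bind_pmf M f) X = (\<Sum>x\<in>set_pmf M. pmf M x * measure_pmf.prob (f x) X)"
proof -
  have "ennreal (measure_pmf.prob (bind_pmf M f) X) = (\<integral>\<^sup>+x. ennreal (measure_pmf.prob (f x) X) \<partial>M)"
    by (simp flip: measure_pmf.emeasure_eq_measure)
  also have "\<dots> = ennreal (\<Sum>x\<in>set_pmf M. pmf M x * measure_pmf.prob (f x) X)"
    using assms by (simp add: nn_integral_measure_pmf_finite ennreal_mult' mult.commute flip: sum_ennreal)
  finally show ?thesis
    by (subst (asm) ennreal_inj) (auto intro!: sum_nonneg mult_nonneg_nonneg)
qed

lemma expectation_finite_pmf: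
  fixes X :: "'a \<Rightarrow> real"
  assumes "finite (set_pmf M)"
  shows "measure_pmf.expectation M X = (\<Sum>x\<in>set_pmf M. pmf M x * X x)"
  using assms by (subst integral_measure_pmf_real[where A = "set_pmf M"]) (auto simp: mult.commute)

lemma finite_set_Pi_pmf:
  assumes "finite A" "\<And>x. x \<in> A \<Longrightarrow> finite (set_pmf (p x))"
  shows "finite (set_pmf (Pi_pmf A d p))"
  using assms by (auto simp: set_Pi_pmf)

lemma expectation_pair_pmf_finite:
  fixes X :: "'a \<Rightarrow> real" and Y :: "'b \<Rightarrow> real"
  assumes "finite (set_pmf M)" "finite (set_pmf N)"
  shows "measure_pmf.expectation (pair_pmf M N) (\<lambda>(x, y). X x * Y y)
    = measure_pmf.expectation M X * measure_pmf.expectation N Y"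
  using assms
  by (simp add: expectation_finite_pmf sum_product pmf_pair algebra_simps sum.cartesian_product case_prod_unfold)
     (intro sum.cong, auto simp: pmf_pair)

text \<open>Splitting \<open>A\<close> into \<open>A\<^sub>1\<close> and the rest turns the product
  law into a pair of independent families. \<open>X\<close> reads only the first; \<open>Y\<close>,
  whose coordinates \<open>A\<^sub>2\<close> avoid \<open>A\<^sub>1\<close>, reads only the
  second.\<close>

lemma expectation_Pi_pmf_indep:
  fixes X Y :: "('a \<Rightarrow> 'b) \<Rightarrow> real"
  assumes fin: "finite A" "\<And>x. x \<in> A \<Longrightarrow> finite (set_pmf (p x))"
    and sub: "A\<^sub>1 \<subseteq> A" "A\<^sub>2 \<subseteq> A" "A\<^sub>1 \<inter> A\<^sub>2 = {}"
    and X: "\<And>f g. (\<And>x. x \<in> A\<^sub>1 \<Longrightarrow> f x = g x) \<Longrightarrow> X f = X g"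
    and Y: "\<And>f g. (\<And>x. x \<in> A\<^sub>2 \<Longrightarrow> f x = g x) \<Longrightarrow> Y f = Y g"
  shows "measure_pmf.expectation (Pi_pmf A d p) (\<lambda>f. X f * Y f)
    = measure_pmf.expectation (Pi_pmf A d p) X * measure_pmf.expectation (Pi_pmf A d p) Y"
proof -
  let ?B = "A - A\<^sub>1"
  let ?P = "Pi_pmf A\<^sub>1 d p" and ?Q = "Pi_pmf ?B d p"
  have A: "A = A\<^sub>1 \<union> ?B" using sub by auto
  have fA: "finite A\<^sub>1" "finite ?B" using fin sub by (auto intro: finite_subset)
  have P: "finite (set_pmf ?P)" "finite (set_pmf ?Q)"
    using fA fin sub by (auto intro!: finite_set_Pi_pmf)
  have eq: "Pi_pmf A d p = map_pmf (\<lambda>(f, g) x. if x \<in> A\<^sub>1 then f x else g x) (pair_pmf ?P ?Q)"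
    by (subst A, rule Pi_pmf_union) (use fA in auto)
  have X': "X (\<lambda>x. if x \<in> A\<^sub>1 then f x else g x) = X f" for f g by (rule X) auto
  have Y': "Y (\<lambda>x. if x \<in> A\<^sub>1 then f x else g x) = Y g" for f g by (rule Y) (use sub in auto)
  have 1: "measure_pmf.expectation (Pi_pmf A d p) (\<lambda>f. X f * Y f)
     = measure_pmf.expectation ?P X * measure_pmf.expectation ?Q Y"
    using expectation_pair_pmf_finite[OF P, of X Y]
    by (simp add: eq X' Y' case_prod_unfold)
  have 2: "measure_pmf.expectation (Pi_pmf A d p) X = measure_pmf.expectation ?P X"
    using expectation_pair_pmf_finite[OF P, of X "\<lambda>_. 1"]
    by (simp add: eq X' case_prod_unfold)
  have 3: "measure_pmf.expectation (Pi_pmf A d p) Y = measure_pmf.expectation ?Q Y"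
    using expectation_pair_pmf_finite[OF P, of "\<lambda>_. 1" Y]
    by (simp add: eq Y' case_prod_unfold)
  show ?thesis by (simp add: 1 2 3)
qed

lemma prob_Pi_pmf_indep:
  assumes fin: "finite A" "\<And>x. x \<in> A \<Longrightarrow> finite (set_pmf (p x))"
    and sub: "A\<^sub>1 \<subseteq> A" "A\<^sub>2 \<subseteq> A" "A\<^sub>1 \<inter> A\<^sub>2 = {}"
    and X: "\<And>f g. (\<And>x. x \<in> A\<^sub>1 \<Longrightarrow> f x = g x) \<Longrightarrow> f \<in> E \<Longrightarrow> g \<in> E"
    and Y: "\<And>f g. (\<And>x. x \<in> A\<^sub>2 \<Longrightarrow> f x = g x) \<Longrightarrow> f \<in> F \<Longrightarrow> g \<in> F"
  shows "measure_pmf.prob (Pi_pmf A d p) (E \<inter> F)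
    = measure_pmf.prob (Pi_pmf A d p) E * measure_pmf.prob (Pi_pmf A d p) F"
proof -
  have "measure_pmf.expectation (Pi_pmf A d p) (\<lambda>f. indicat_real E f * indicat_real F f)
    = measure_pmf.expectation (Pi_pmf A d p) (indicat_real E)
      * measure_pmf.expectation (Pi_pmf A d p) (indicat_real F)"
    by (rule expectation_Pi_pmf_indep[OF fin sub])
       (use X Y in \<open>simp_all add: indicator_def\<close>, (metis (full_types))+)
  then show ?thesis
    by (simp flip: indicator_inter_arith)
qed

lemma expectation_Pi_pmf_component:
  fixes h :: "'b \<Rightarrow> real"
  assumes "finite A" "x \<in> A"
  shows "measure_pmf.expectation (Pi_pmf A d p) (\<lambda>f. h (f x)) = measure_pmf.expectation (p x) h"
proof -
  have "p x = map_pmf (\<lambda>f. f x) (Pi_pmf A d p)"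
    using assms by (simp add: Pi_pmf_component)
  then show ?thesis by simp
qed

lemma prob_Pi_pmf_component:
  assumes "finite A" "x \<in> A"
  shows "measure_pmf.prob (Pi_pmf A d p) {f. f x \<in> E} = measure_pmf.prob (p x) E"
proof -
  have "p x = map_pmf (\<lambda>f. f x) (Pi_pmf A d p)"
    using assms by (simp add: Pi_pmf_component)
  then show ?thesis by (simp add: vimage_def)
qed

section \<open>Second-moment bounds for sums and counts\<close>

lemma chebyshev_uncorrelated:
  fixes X :: "'i \<Rightarrow> 'a \<Rightarrow> real"
  assumes M: "finite (set_pmf M)" and I: "finite I" and a: "a > 0"
    and uncor: "\<And>v w. v \<in> I \<Longrightarrow> w \<in> I \<Longrightarrow> v \<noteq> w \<Longrightarrow>
      measure_pmf.expectation M (\<lambda>x. X v x * X w x)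
        = measure_pmf.expectation M (X v) * measure_pmf.expectation M (X w)"
  shows "measure_pmf.prob M {x. a \<le> \<bar>(\<Sum>v\<in>I. X v x) - (\<Sum>v\<in>I. measure_pmf.expectation M (X v))\<bar>}
    \<le> (\<Sum>v\<in>I. measure_pmf.expectation M (\<lambda>x. (X v x)\<^sup>2)) / a\<^sup>2"
proof -
  let ?E = "measure_pmf.expectation M"
  have int [simp]: "integrable (measure_pmf M) f" for f :: "'a \<Rightarrow> real"
    by (rule integrable_measure_pmf_finite[OF M])
  have m: "?E (\<lambda>x. \<Sum>v\<in>I. X v x) = (\<Sum>v\<in>I. ?E (X v))"
    by (subst Bochner_Integration.integral_sum) auto
  have "measure_pmf.variance M (\<lambda>x. \<Sum>v\<in>I. X v x) = ?E (\<lambda>x. (\<Sum>v\<in>I. X v x)\<^sup>2) - (\<Sum>v\<in>I. ?E (X v))\<^sup>2"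
    by (subst measure_pmf.variance_eq) (auto simp: m)
  also have "?E (\<lambda>x. (\<Sum>v\<in>I. X v x)\<^sup>2) = (\<Sum>v\<in>I. \<Sum>w\<in>I. ?E (\<lambda>x. X v x * X w x))"
    by (simp add: power2_eq_square sum_product Bochner_Integration.integral_sum)
  also have "\<dots> - (\<Sum>v\<in>I. ?E (X v))\<^sup>2
      = (\<Sum>v\<in>I. \<Sum>w\<in>I. ?E (\<lambda>x. X v x * X w x) - ?E (X v) * ?E (X w))"
    by (simp add: power2_eq_square sum_product sum_subtractf)
  \<comment> \<open>Off-diagonal covariances vanish. On the diagonal the squared mean is then
    dropped, so that only second moments have to be computed later.\<close>
  also have "\<dots> = (\<Sum>v\<in>I. \<Sum>w\<in>I. if w = v then ?E (\<lambda>x. (X v x)\<^sup>2) - (?E (X v))\<^sup>2 else 0)"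
    by (intro sum.cong refl) (auto simp: uncor power2_eq_square)
  also have "\<dots> \<le> (\<Sum>v\<in>I. ?E (\<lambda>x. (X v x)\<^sup>2))"
    using I by (auto simp: sum.delta intro!: sum_mono)
  finally have var: "measure_pmf.variance M (\<lambda>x. \<Sum>v\<in>I. X v x) \<le> (\<Sum>v\<in>I. ?E (\<lambda>x. (X v x)\<^sup>2))" .
  have "measure_pmf.prob M {x. a \<le> \<bar>(\<Sum>v\<in>I. X v x) - (\<Sum>v\<in>I. ?E (X v))\<bar>}
     \<le> measure_pmf.variance M (\<lambda>x. \<Sum>v\<in>I. X v x) / a\<^sup>2"
    using measure_pmf.Chebyshev_inequality[of "\<lambda>x. \<Sum>v\<in>I. X v x" M a] a by (simp add: m)
  also have "\<dots> \<le> (\<Sum>v\<in>I. ?E (\<lambda>x. (X v x)\<^sup>2)) / a\<^sup>2"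
    using var by (rule divide_right_mono) simp
  finally show ?thesis .
qed

text \<open>The number of indices with \<open>A v\<close> concentrates by Chebyshev; the number
  spoiled by \<open>C v\<close> is controlled in expectation only, by Markov, which tolerates any
  dependence between the \<open>C v\<close>.\<close>

lemma prob_card_good_small:
  fixes A C :: "'i \<Rightarrow> 'a set"
  assumes M: "finite (set_pmf M)" and I: "finite I"
    and uncor: "\<And>v w. v \<in> I \<Longrightarrow> w \<in> I \<Longrightarrow> v \<noteq> w \<Longrightarrow>
      measure_pmf.prob M (A v \<inter> A w) = measure_pmf.prob M (A v) * measure_pmf.prob M (A w)"
    and C: "\<And>v. v \<in> I \<Longrightarrow> measure_pmf.prob M (A v \<inter> C v) \<le> measure_pmf.prob M (A v) * \<kappa>"
    and p: "p > 0" "I \<noteq> {}" "\<And>v. v \<in> I \<Longrightarrow> p \<le> measure_pmf.prob M (A v)"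
  shows "measure_pmf.prob M {x. real (card {v \<in> I. x \<in> A v - C v}) < real (card I) * p / 4}
    \<le> 4 / (real (card I) * p) + 4 * \<kappa>"
proof -
  define \<mu> where "\<mu> = (\<Sum>v\<in>I. measure_pmf.prob M (A v))"
  let ?X = "\<lambda>x. \<Sum>v\<in>I. indicat_real (A v) x"
  let ?Y = "\<lambda>x. \<Sum>v\<in>I. indicat_real (A v \<inter> C v) x"
  have \<mu>: "real (card I) * p \<le> \<mu>"
    unfolding \<mu>_def using p sum_bounded_below[of I p "\<lambda>v. measure_pmf.prob M (A v)"] by simp
  have pos: "0 < real (card I) * p" using p I by (simp add: card_gt_0_iff)
  with \<mu> have \<mu>0: "\<mu> > 0" by linarith
  have count: "real (card {v \<in> I. x \<in> A v - C v}) = ?X x - ?Y x" for x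
  proof -
    have "real (card {v \<in> I. x \<in> A v - C v}) = (\<Sum>v\<in>I. of_bool (x \<in> A v - C v))"
      using I by (simp add: Int_def)
    also have "\<dots> = (\<Sum>v\<in>I. indicat_real (A v) x - indicat_real (A v \<inter> C v) x)"
      by (intro sum.cong) (auto simp: indicator_def)
    finally show ?thesis by (simp add: sum_subtractf)
  qed
  \<comment> \<open>An indicator equals its square, so the Chebyshev numerator is again
    \<open>\<mu>\<close>.\<close>
  have "measure_pmf.prob M {x. \<mu> / 2 \<le> \<bar>?X x - \<mu>\<bar>} \<le> \<mu> / (\<mu> / 2)\<^sup>2"
    using chebyshev_uncorrelated[OF M I, of "\<mu> / 2" "\<lambda>v. indicat_real (A v)"] \<mu>0 uncor
    by (simp add: \<mu>_def flip: indicator_inter_arith)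
       (simp add: power2_eq_square flip: indicator_inter_arith)
  also have "\<dots> = 4 / \<mu>" using \<mu>0 by (simp add: power2_eq_square field_simps)
  also have "\<dots> \<le> 4 / (real (card I) * p)" using \<mu> pos by (intro divide_left_mono) auto
  finally have 1: "measure_pmf.prob M {x. \<mu> / 2 \<le> \<bar>?X x - \<mu>\<bar>} \<le> 4 / (real (card I) * p)" .
  have "measure_pmf.prob M {x. \<mu> / 4 \<le> ?Y x} \<le> measure_pmf.expectation M ?Y / (\<mu> / 4)"
    using integral_Markov_inequality_measure[of "measure_pmf M" ?Y "{}" "\<mu> / 4"] \<mu>0
    by (simp add: integrable_measure_pmf_finite[OF M] sum_nonneg)
  also have "measure_pmf.expectation M ?Y = (\<Sum>v\<in>I. measure_pmf.prob M (A v \<inter> C v))"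
    by (subst Bochner_Integration.integral_sum) (auto intro: integrable_measure_pmf_finite[OF M])
  also have "\<dots> \<le> \<mu> * \<kappa>"
    unfolding \<mu>_def sum_distrib_right by (intro sum_mono C)
  finally have 2: "measure_pmf.prob M {x. \<mu> / 4 \<le> ?Y x} \<le> 4 * \<kappa>"
    using \<mu>0 by (simp add: field_simps)
  \<comment> \<open>With \<open>?X\<close> above \<open>\<mu> / 2\<close> and \<open>?Y\<close>
    below \<open>\<mu> / 4\<close>, more than \<open>\<mu> / 4\<close> good indices remain, and
    \<open>\<mu> / 4\<close> is at least the threshold.\<close>
  have "{x. real (card {v \<in> I. x \<in> A v - C v}) < real (card I) * p / 4}
      \<subseteq> {x. \<mu> / 2 \<le> \<bar>?X x - \<mu>\<bar>} \<union> {x. \<mu> / 4 \<le> ?Y x}"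
  proof
    fix x assume "x \<in> {x. real (card {v \<in> I. x \<in> A v - C v}) < real (card I) * p / 4}"
    then have "?X x - ?Y x < \<mu> / 4" using \<mu> unfolding count by simp
    then show "x \<in> {x. \<mu> / 2 \<le> \<bar>?X x - \<mu>\<bar>} \<union> {x. \<mu> / 4 \<le> ?Y x}"
      by (simp add: abs_if) linarith
  qed
  then have "measure_pmf.prob M {x. real (card {v \<in> I. x \<in> A v - C v}) < real (card I) * p / 4}
     \<le> measure_pmf.prob M {x. \<mu> / 2 \<le> \<bar>?X x - \<mu>\<bar>} + measure_pmf.prob M {x. \<mu> / 4 \<le> ?Y x}"
    by (intro order_trans[OF measure_pmf.finite_measure_mono measure_subadditive]) auto
  with 1 2 show ?thesis by linarith
qed

text \<open>The coordinatewise density comparisons multiply, and on \<open>E\<close> the accumulated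
  exponent is at most \<open>b\<close>. A one-sided comparison is enough for a lower bound, so
  \<open>p'\<close> may be an unnormalized tilt whose missing mass is placed elsewhere.\<close>

lemma prob_Pi_pmf_tilt:
  fixes L :: "'a \<Rightarrow> 'b \<Rightarrow> real"
  assumes fin: "finite A" "\<And>x. x \<in> A \<Longrightarrow> finite (set_pmf (p x))" "\<And>x. x \<in> A \<Longrightarrow> finite (set_pmf (p' x))"
    and z: "\<And>x. x \<in> A \<Longrightarrow> 0 \<le> z x"
    and tilt: "\<And>x y. x \<in> A \<Longrightarrow> z x * exp (- L x y) * pmf (p' x) y \<le> pmf (p x) y"
    and E: "\<And>f. f \<in> E \<Longrightarrow> (\<Sum>x\<in>A. L x (f x)) \<le> b"
  shows "(\<Prod>x\<in>A. z x) * exp (- b) * measure_pmf.prob (Pi_pmf A d p') E \<le> measure_pmf.prob (Pi_pmf A d p) E"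
proof -
  let ?Q = "Pi_pmf A d p'" and ?P = "Pi_pmf A d p"
  have f: "finite (set_pmf ?P)" "finite (set_pmf ?Q)"
    using fin by (auto intro!: finite_set_Pi_pmf)
  have pt: "(\<Prod>x\<in>A. z x) * exp (- b) * pmf ?Q f \<le> pmf ?P f" if "f \<in> E" for f
  \<comment> \<open>A function differing from the default \<open>d\<close> somewhere off
    \<open>A\<close> has mass zero under both laws.\<close>
  proof (cases "\<forall>x. x \<notin> A \<longrightarrow> f x = d")
    case True
    have "(\<Prod>x\<in>A. z x) * exp (- b) * pmf ?Q f
       \<le> (\<Prod>x\<in>A. z x) * exp (- (\<Sum>x\<in>A. L x (f x))) * pmf ?Q f"
      using E[OF that] z by (intro mult_right_mono mult_left_mono) (auto intro!: prod_nonneg)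
    also have "\<dots> = (\<Prod>x\<in>A. z x * exp (- L x (f x)) * pmf (p' x) (f x))"
      using True fin by (simp add: pmf_Pi prod.distrib exp_sum flip: sum_negf)
    also have "\<dots> \<le> (\<Prod>x\<in>A. pmf (p x) (f x))"
      using z tilt by (intro prod_mono) auto
    also have "\<dots> = pmf ?P f" using True fin by (simp add: pmf_Pi)
    finally show ?thesis .
  qed (use fin in \<open>auto simp: pmf_Pi\<close>)
  let ?F = "E \<inter> (set_pmf ?P \<union> set_pmf ?Q)"
  have fF: "finite ?F" using f by auto
  have "measure_pmf.prob ?Q E = sum (pmf ?Q) ?F" "measure_pmf.prob ?P E = sum (pmf ?P) ?F"
    using fF by (auto simp: measure_measure_pmf_finite[symmetric] intro!: measure_prob_cong_0 simp: set_pmf_iff)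
  then show ?thesis
    using pt by (auto simp: sum_distrib_left intro!: sum_mono)
qed

subsection \<open>Posterior bound for exact recovery\<close>

text \<open>On \<open>T\<close> the posterior probability of \<open>s\<close> given \<open>g\<close> is at most \<open>1 / H\<close>.\<close>

lemma prob_joint_le_posterior:
  fixes M :: "('s \<times> 'g) pmf" and est :: "'g \<Rightarrow> 'e pmf" and R :: "'s \<Rightarrow> 'e \<Rightarrow> bool"
  assumes M: "finite (set_pmf M)"
    and N: "\<And>e. card {s \<in> fst ` set_pmf M. R s e} \<le> N"
    and H: "H > 0"
    and T: "\<And>s g. (s, g) \<in> set_pmf M \<Longrightarrow> (s, g) \<in> T \<Longrightarrow> pmf M (s, g) * H \<le> pmf (map_pmf snd M) g"
  shows "measure_pmf.prob (M \<bind> (\<lambda>(s, g). est g \<bind> (\<lambda>e. return_pmf (s, e)))) {(s, e). R s e}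
     \<le> measure_pmf.prob M (- T) + real N / H"
proof -
  define r where "r = (\<lambda>s g. measure_pmf.prob (est g) {e. R s e})"
  define S where "S = fst ` set_pmf M"
  define \<Gamma> where "\<Gamma> = snd ` set_pmf M"
  have fin: "finite S" "finite \<Gamma>" using M by (auto simp: S_def \<Gamma>_def)
  have r: "0 \<le> r s g" "r s g \<le> 1" for s g by (auto simp: r_def)
  have int: "integrable (measure_pmf (est g)) (indicat_real X)" for g X
    by (rule measure_pmf.integrable_const_bound[where B = 1]) auto
  have T': "pmf M (s, g) \<le> pmf (map_pmf snd M) g / H" if "(s, g) \<in> set_pmf M" "(s, g) \<in> T" for s g
    using T[OF that] H by (simp add: pos_le_divide_eq)
  \<comment> \<open>For a fixed graph, summing the success probability over all truths gives the
    expected number of truths compatible with the random estimate.\<close>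
  have sumr: "(\<Sum>s\<in>S. r s g) \<le> real N" for g
  proof -
    have "(\<Sum>s\<in>S. r s g) = measure_pmf.expectation (est g) (\<lambda>e. \<Sum>s\<in>S. indicator {e. R s e} e)"
      by (subst Bochner_Integration.integral_sum) (auto simp: r_def int)
    also have "\<dots> \<le> measure_pmf.expectation (est g) (\<lambda>e. real N)"
    proof (rule integral_mono)
      fix e
      have "(\<Sum>s\<in>S. indicator {e. R s e} e :: real) = real (card {s \<in> S. R s e})"
        using fin by (simp add: indicator_def Int_def)
      also have "\<dots> \<le> real N" using N by (simp add: S_def)
      finally show "(\<Sum>s\<in>S. indicat_real {e. R s e} e) \<le> real N" .
    qed (auto intro!: Bochner_Integration.integrable_sum int)
    finally show ?thesis by simp
  qed
  have joint: "(\<lambda>(s, g). est g \<bind> (\<lambda>e. return_pmf (s, e))) = (\<lambda>(s, g). map_pmf (Pair s) (est g))"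
    by (auto simp: map_pmf_def)
  have "measure_pmf.prob (M \<bind> (\<lambda>(s, g). est g \<bind> (\<lambda>e. return_pmf (s, e)))) {(s, e). R s e}
     = (\<Sum>(s, g)\<in>set_pmf M. pmf M (s, g) * r s g)"
    unfolding joint by (subst prob_bind_pmf_finite[OF M]) (auto simp: r_def vimage_def intro!: sum.cong)
  \<comment> \<open>Off \<open>T\<close> the success probability is bounded by 1; on
    \<open>T\<close> the joint mass is replaced by the graph marginal divided by
    \<open>H\<close>.\<close>
  also have "\<dots> = (\<Sum>(s, g)\<in>set_pmf M \<inter> - T. pmf M (s, g) * r s g)
      + (\<Sum>(s, g)\<in>set_pmf M \<inter> T. pmf M (s, g) * r s g)"
    by (subst sum.union_disjoint[symmetric]) (use M in \<open>auto intro!: sum.cong\<close>)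
  also have "(\<Sum>(s, g)\<in>set_pmf M \<inter> - T. pmf M (s, g) * r s g) \<le> (\<Sum>x\<in>set_pmf M \<inter> - T. pmf M x)"
    using r by (auto intro!: sum_mono mult_left_le)
  also have "\<dots> = measure_pmf.prob M (- T)"
    using M by (subst measure_Int_set_pmf[symmetric]) (simp add: measure_measure_pmf_finite Int_commute)
  also have "(\<Sum>(s, g)\<in>set_pmf M \<inter> T. pmf M (s, g) * r s g)
      \<le> (\<Sum>(s, g)\<in>set_pmf M \<inter> T. pmf (map_pmf snd M) g / H * r s g)"
    using T' r by (auto intro!: sum_mono mult_right_mono simp del: times_divide_eq_left)
  \<comment> \<open>Enlarging the index set to a full product allows summing over \<open>s\<close>
    first, where \<open>sumr\<close> applies.\<close>
  also have "\<dots> \<le> (\<Sum>(s, g)\<in>S \<times> \<Gamma>. pmf (map_pmf snd M) g / H * r s g)"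
    using fin H r by (intro sum_mono2) (force simp: S_def \<Gamma>_def)+
  also have "\<dots> = (\<Sum>g\<in>\<Gamma>. pmf (map_pmf snd M) g / H * (\<Sum>s\<in>S. r s g))"
    by (subst sum.cartesian_product[symmetric], subst sum.swap) (simp add: sum_distrib_left)
  also have "\<dots> \<le> (\<Sum>g\<in>\<Gamma>. pmf (map_pmf snd M) g / H * real N)"
    using H by (intro sum_mono mult_left_mono sumr) auto
  also have "\<dots> = (\<Sum>g\<in>\<Gamma>. pmf (map_pmf snd M) g) * (real N / H)"
    unfolding sum_distrib_right by (intro sum.cong) auto
  also have "(\<Sum>g\<in>\<Gamma>. pmf (map_pmf snd M) g) = 1"
    using fin by (intro sum_pmf_eq_1) (auto simp: \<Gamma>_def)
  finally show ?thesis by simp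
qed

section \<open>Truths compatible with a given estimate\<close>

lemma exact_recovery_imp_permutation:
  assumes "exact_recovery n \<sigma>\<^sub>0 \<sigma>"
  shows "\<exists>\<pi>. \<forall>u\<in>{1..n}. \<sigma>\<^sub>0 u = \<pi> (\<sigma> u)"
proof -
  obtain J where J: "permutation_matrix J"
    "\<And>u. u \<in> {1..n} \<Longrightarrow> membership_row \<sigma> u v* J = membership_row \<sigma>\<^sub>0 u"
    using assms unfolding exact_recovery_def by auto
  obtain \<pi> where \<pi>: "J = (\<chi> i j. of_bool (j = \<pi> i))"
    using J(1) unfolding permutation_matrix_def by auto
  have "\<sigma>\<^sub>0 u = \<pi> (\<sigma> u)" if u: "u \<in> {1..n}" for u
  proof -
    \<comment> \<open>The entry in column \<open>\<sigma>\<^sub>0 u\<close> is 1 on the right; on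
      the left it would vanish if \<open>\<pi> (\<sigma> u)\<close> were another community.\<close>
    have "(membership_row \<sigma> u v* J) $ \<sigma>\<^sub>0 u = 1"
      using J(2)[OF u] by (simp add: membership_row_def)
    then have "(\<Sum>i\<in>UNIV. of_bool (\<sigma>\<^sub>0 u = \<pi> i) * of_bool (\<sigma> u = i)) = (1 :: real)"
      by (simp add: \<pi> vector_matrix_mult_def membership_row_def Int_commute)
    moreover have "of_bool (\<sigma>\<^sub>0 u = \<pi> i) * of_bool (\<sigma> u = i) = (0 :: real)"
      if "\<sigma>\<^sub>0 u \<noteq> \<pi> (\<sigma> u)" for i
      using that by auto
    ultimately show ?thesis
      by (metis (no_types, lifting) sum.neutral zero_neq_one)
  qed
  then show ?thesis by blast
qed

text \<open>Since labellings are frozen to \<open>undefined\<close> off \<open>{1..n}\<close>, a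
  compatible truth is determined by the relabelling map. Counting all maps instead of permutations
  is harmless: the bound is independent of \<open>n\<close>.\<close>

lemma card_exact_recovery_le:
  fixes \<sigma> :: "nat \<Rightarrow> 'k::finite"
  assumes "\<And>\<sigma>\<^sub>0 u. \<sigma>\<^sub>0 \<in> S \<Longrightarrow> u \<notin> {1..n} \<Longrightarrow> \<sigma>\<^sub>0 u = undefined"
  shows "card {\<sigma>\<^sub>0 \<in> S. exact_recovery n \<sigma>\<^sub>0 \<sigma>} \<le> card (UNIV :: ('k \<Rightarrow> 'k) set)"
proof -
  have "{\<sigma>\<^sub>0 \<in> S. exact_recovery n \<sigma>\<^sub>0 \<sigma>}
    \<subseteq> range (\<lambda>\<pi> u. if u \<in> {1..n} then \<pi> (\<sigma> u) else undefined)"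
  proof safe
    fix \<sigma>\<^sub>0 assume "\<sigma>\<^sub>0 \<in> S" "exact_recovery n \<sigma>\<^sub>0 \<sigma>"
    moreover from this obtain \<pi> where "\<forall>u\<in>{1..n}. \<sigma>\<^sub>0 u = \<pi> (\<sigma> u)"
      using exact_recovery_imp_permutation by blast
    ultimately have "\<sigma>\<^sub>0 = (\<lambda>u. if u \<in> {1..n} then \<pi> (\<sigma> u) else undefined)"
      using assms by fastforce
    then show "\<sigma>\<^sub>0 \<in> range (\<lambda>\<pi> u. if u \<in> {1..n} then \<pi> (\<sigma> u) else undefined)" by blast
  qed
  then show ?thesis
    by (meson card_image_le card_mono finite finite_imageI le_trans)
qed

subsection \<open>Status laws and their exponential tilts\<close>

lemma finite_set_status_pmf: "finite (set_pmf (M :: status pmf))"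
proof -
  have "UNIV = {Present, Absent, Censored}" by (auto intro: status.exhaust)
  then show ?thesis by (metis finite.emptyI finite.insertI finite_subset top_greatest)
qed

lemma pmf_status_pmf:
  assumes "0 \<le> p" "p \<le> 1" "0 \<le> q" "q \<le> 1"
  shows "pmf (status_pmf p q) Present = p * q"
    and "pmf (status_pmf p q) Absent = (1 - p) * q"
    and "pmf (status_pmf p q) Censored = 1 - q"
  using assms by (simp_all add: status_pmf_def pmf_bind algebra_simps)

section \<open>Weighted geometric means of Bernoulli parameters\<close>

definition geo :: "real \<Rightarrow> real \<Rightarrow> real \<Rightarrow> real" where
  "geo \<xi> a b = a powr \<xi> * b powr (1 - \<xi>)"

text \<open>The Chernoff coefficient of two Bernoulli laws; at \<open>\<xi> = 1 / 2\<close> it is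
  the Hellinger affinity.\<close>

definition affinity :: "real \<Rightarrow> real \<Rightarrow> real \<Rightarrow> real" where
  "affinity \<xi> a b = geo \<xi> a b + geo \<xi> (1 - a) (1 - b)"

text \<open>Log-likelihood of parameter \<open>b\<close> against \<open>a\<close>. The revealing
  probability cancels, and a censored pair carries no information.\<close>

fun log_ratio :: "real \<Rightarrow> real \<Rightarrow> status \<Rightarrow> real" where
  "log_ratio a b Present = ln (b / a)"
| "log_ratio a b Absent = ln ((1 - b) / (1 - a))"
| "log_ratio a b Censored = 0"

text \<open>The mean log-ratio under the tilted law, per unit of revealing probability;
  \<open>spread\<close> below is the corresponding second moment.\<close>

definition drift :: "real \<Rightarrow> real \<Rightarrow> real \<Rightarrow> real" where
  "drift \<xi> a b = geo \<xi> a b * log_ratio a b Present + geo \<xi> (1 - a) (1 - b) * log_ratio a b Absent"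

definition spread :: "real \<Rightarrow> real \<Rightarrow> real \<Rightarrow> real" where
  "spread \<xi> a b = geo \<xi> a b * (log_ratio a b Present)\<^sup>2 + geo \<xi> (1 - a) (1 - b) * (log_ratio a b Absent)\<^sup>2"

text \<open>
  The revealed statuses get weights \<open>q a\<^sup>\<xi> b\<^bsup>1-\<xi>\<^esup>\<close> and \<open>q (1-a)\<^sup>\<xi> (1-b)\<^bsup>1-\<xi>\<^esup>\<close>. Giving the remaining mass
  to \<^const>\<open>Censored\<close>, instead of normalizing, makes the mean log-ratio exactly linear in \<open>q\<close>, at the
  price of an inequality in the change of measure.
\<close>

definition tilted_pmf :: "real \<Rightarrow> real \<Rightarrow> real \<Rightarrow> real \<Rightarrow> status pmf" where
  "tilted_pmf \<xi> a b q = status_pmf (geo \<xi> a b / affinity \<xi> a b) (q * affinity \<xi> a b)"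

lemma geo_pos: "0 < a \<Longrightarrow> 0 < b \<Longrightarrow> 0 < geo \<xi> a b"
  by (simp add: geo_def)

text \<open>Weighted AM-GM, from convexity of the exponential.\<close>

lemma geo_le:
  assumes "0 < a" "0 < b" "0 \<le> \<xi>" "\<xi> \<le> 1"
  shows "geo \<xi> a b \<le> \<xi> * a + (1 - \<xi>) * b"
proof -
  have "geo \<xi> a b = exp (\<xi> * ln a + (1 - \<xi>) * ln b)"
    using assms by (simp add: geo_def powr_def exp_add)
  also have "\<dots> \<le> \<xi> * exp (ln a) + (1 - \<xi>) * exp (ln b)"
    using convex_onD[OF exp_convex, of "1 - \<xi>" "ln a" "ln b"] assms by simp
  finally show ?thesis using assms by simp
qed

text \<open>Undoing the tilt: \<open>geo\<close> is \<open>a\<close> times the likelihood ratio to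
  the power \<open>1 - \<xi>\<close>.\<close>

lemma geo_exp_log_ratio:
  assumes "0 < a" "0 < b"
  shows "exp (- ((1 - \<xi>) * ln (b / a))) * geo \<xi> a b = a"
  using assms
  by (simp add: geo_def powr_def ln_div flip: exp_add) (simp add: algebra_simps)

context
  fixes \<xi> a b :: real
  assumes ab: "0 < a" "a < 1" "0 < b" "b < 1" and \<xi>: "0 < \<xi>" "\<xi> < 1"
begin

lemma affinity_pos: "0 < affinity \<xi> a b"
  unfolding affinity_def using ab by (intro add_pos_pos geo_pos) auto

lemma affinity_le_1: "affinity \<xi> a b \<le> 1"
  using geo_le[of a b \<xi>] geo_le[of "1 - a" "1 - b" \<xi>] ab \<xi>
  by (simp add: affinity_def algebra_simps)

lemma pmf_tilted_pmf:
  assumes "0 \<le> q" "q \<le> 1"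
  shows "pmf (tilted_pmf \<xi> a b q) Present = q * geo \<xi> a b"
    and "pmf (tilted_pmf \<xi> a b q) Absent = q * geo \<xi> (1 - a) (1 - b)"
    and "pmf (tilted_pmf \<xi> a b q) Censored = 1 - q * affinity \<xi> a b"
proof -
  have g: "0 < geo \<xi> a b" "0 < geo \<xi> (1 - a) (1 - b)" using ab by (auto intro!: geo_pos)
  \<comment> \<open>Both Bernoulli parameters of \<open>tilted_pmf\<close> must lie in the unit
    interval, since otherwise \<open>bernoulli_pmf\<close> would truncate them.\<close>
  have w: "q * affinity \<xi> a b \<le> 1"
    using affinity_le_1 affinity_pos assms by (simp add: mult_le_one)
  have p: "geo \<xi> a b / affinity \<xi> a b \<le> 1"
    using g by (simp add: affinity_def)
  have "1 - geo \<xi> a b / affinity \<xi> a b = geo \<xi> (1 - a) (1 - b) / affinity \<xi> a b"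
    using affinity_pos by (simp add: field_simps) (simp add: affinity_def)
  then show "pmf (tilted_pmf \<xi> a b q) Present = q * geo \<xi> a b"
    "pmf (tilted_pmf \<xi> a b q) Absent = q * geo \<xi> (1 - a) (1 - b)"
    "pmf (tilted_pmf \<xi> a b q) Censored = 1 - q * affinity \<xi> a b"
    unfolding tilted_pmf_def using g w p affinity_pos assms
    by (simp_all add: pmf_status_pmf)
qed

lemma expectation_tilted_pmf:
  assumes "0 \<le> q" "q \<le> 1"
  shows "measure_pmf.expectation (tilted_pmf \<xi> a b q) (log_ratio a b) = q * drift \<xi> a b"
    and "measure_pmf.expectation (tilted_pmf \<xi> a b q) (\<lambda>y. (log_ratio a b y)\<^sup>2) = q * spread \<xi> a b"
proof -
  have "measure_pmf.expectation (tilted_pmf \<xi> a b q) h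
    = q * (geo \<xi> a b * h Present + geo \<xi> (1 - a) (1 - b) * h Absent)
      + (1 - q * affinity \<xi> a b) * h Censored" for h :: "status \<Rightarrow> real"
    using assms
    by (subst integral_measure_pmf_real[where A = "{Present, Absent, Censored}"])
       (auto simp: pmf_tilted_pmf algebra_simps intro: status.exhaust)
  then show "measure_pmf.expectation (tilted_pmf \<xi> a b q) (log_ratio a b) = q * drift \<xi> a b"
    "measure_pmf.expectation (tilted_pmf \<xi> a b q) (\<lambda>y. (log_ratio a b y)\<^sup>2) = q * spread \<xi> a b"
    by (simp_all add: drift_def spread_def)
qed

text \<open>For revealed statuses the exponential undoes the tilt exactly and the prefactor, at most
  1, is mere loss. For \<open>Censored\<close> the prefactor is the exact ratio of the two
  masses.\<close>

lemma tilted_pmf_le_status_pmf: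
  assumes q: "0 \<le> q" "q < 1"
  shows "(1 - q) / (1 - q * affinity \<xi> a b) * exp (- ((1 - \<xi>) * log_ratio a b y)) * pmf (tilted_pmf \<xi> a b q) y
    \<le> pmf (status_pmf a q) y"
proof -
  have qW: "q * affinity \<xi> a b \<le> q"
    using affinity_le_1 q by (simp add: mult_left_le)
  define z where "z = (1 - q) / (1 - q * affinity \<xi> a b)"
  have z: "0 \<le> z" "z \<le> 1" "z * (1 - q * affinity \<xi> a b) = 1 - q"
    using qW q by (auto simp: z_def divide_simps)
  show ?thesis
  proof (cases y)
    case Present
    have "z * exp (- ((1 - \<xi>) * ln (b / a))) * (q * geo \<xi> a b)
        = z * (a * q)"
      using geo_exp_log_ratio[of a b \<xi>] ab by (simp add: mult.assoc mult.left_commute[of _ q] mult.commute)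
    also have "\<dots> \<le> a * q" using z ab q by (intro mult_left_le_one_le) auto
    finally show ?thesis using Present q ab by (simp add: pmf_tilted_pmf pmf_status_pmf flip: z_def)
  next
    case Absent
    have "z * exp (- ((1 - \<xi>) * ln ((1 - b) / (1 - a)))) * (q * geo \<xi> (1 - a) (1 - b))
        = z * ((1 - a) * q)"
      using geo_exp_log_ratio[of "1 - a" "1 - b" \<xi>] ab by (simp add: mult.assoc mult.left_commute[of _ q] mult.commute)
    also have "\<dots> \<le> (1 - a) * q" using z ab q by (intro mult_left_le_one_le) auto
    finally show ?thesis using Absent q ab by (simp add: pmf_tilted_pmf pmf_status_pmf flip: z_def)
  next
    case Censored
    then show ?thesis using q ab z by (simp add: pmf_tilted_pmf pmf_status_pmf flip: z_def)
  qed
qed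

lemma pmf_status_pmf_log_ratio:
  assumes "0 \<le> q" "q \<le> 1"
  shows "pmf (status_pmf b q) y = exp (log_ratio a b y) * pmf (status_pmf a q) y"
  using assms ab by (cases y) (simp_all add: pmf_status_pmf)

end

subsection \<open>The joint law of labels and graph\<close>

lemma finite_vertex_pairs [simp]: "finite (vertex_pairs n)"
proof -
  have "vertex_pairs n \<subseteq> {1..n} \<times> {1..n}" by (auto simp: vertex_pairs_def)
  then show ?thesis by (rule finite_subset) auto
qed

definition graph_pmf :: "nat \<Rightarrow> real ^ 'k ^ 'k \<Rightarrow> real \<Rightarrow> (nat \<Rightarrow> 'k::finite) \<Rightarrow> observed_graph pmf" where
  "graph_pmf n P q \<sigma> = Pi_pmf (vertex_pairs n) Censored (\<lambda>(u, v). status_pmf (P $ \<sigma> u $ \<sigma> v) q)"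

lemma finite_set_graph_pmf: "finite (set_pmf (graph_pmf n P q \<sigma>))"
  unfolding graph_pmf_def by (intro finite_set_Pi_pmf) (auto simp: finite_set_status_pmf)

definition label_pmf :: "nat \<Rightarrow> real ^ 'k \<Rightarrow> (nat \<Rightarrow> 'k::finite) pmf" where
  "label_pmf n \<rho> = Pi_pmf {1..n} undefined (\<lambda>_. community_pmf \<rho>)"

lemma finite_set_label_pmf: "finite (set_pmf (label_pmf n \<rho>))"
  unfolding label_pmf_def by (intro finite_set_Pi_pmf) auto

lemma CSBM_eq:
  "CSBM n \<rho> P t = label_pmf n \<rho> \<bind> (\<lambda>\<sigma>. map_pmf (Pair \<sigma>) (graph_pmf n P (t * ln (real n) / real n) \<sigma>))"
  by (simp add: CSBM_def label_pmf_def graph_pmf_def map_pmf_def)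

lemma finite_set_CSBM: "finite (set_pmf (CSBM n \<rho> P t))"
  by (simp add: CSBM_eq finite_set_label_pmf finite_set_graph_pmf)

lemma pmf_CSBM:
  "pmf (CSBM n \<rho> P t) (\<sigma>, G) = pmf (label_pmf n \<rho>) \<sigma> * pmf (graph_pmf n P (t * ln (real n) / real n) \<sigma>) G"
proof -
  have pair: "measure_pmf.prob (map_pmf (Pair \<tau>) N) {(\<sigma>, G)} = (if \<tau> = \<sigma> then pmf N G else 0)"
    for \<tau> and N :: "observed_graph pmf"
  proof -
    have "Pair \<tau> -` {(\<sigma>, G)} = (if \<tau> = \<sigma> then {G} else {})" by auto
    then show ?thesis by (simp only: measure_map_pmf) (simp add: measure_pmf_single)
  qed
  have "pmf (CSBM n \<rho> P t) (\<sigma>, G) = measure_pmf.prob (CSBM n \<rho> P t) {(\<sigma>, G)}"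
    by (simp add: measure_pmf_single)
  also have "\<dots> = (\<Sum>\<tau>\<in>set_pmf (label_pmf n \<rho>). if \<tau> = \<sigma>
      then pmf (label_pmf n \<rho>) \<sigma> * pmf (graph_pmf n P (t * ln (real n) / real n) \<sigma>) G else 0)"
    unfolding CSBM_eq
    by (subst prob_bind_pmf_finite[OF finite_set_label_pmf])
       (simp only: pair, auto intro!: sum.cong)
  also have "\<dots> = pmf (label_pmf n \<rho>) \<sigma> * pmf (graph_pmf n P (t * ln (real n) / real n) \<sigma>) G"
    by (auto simp: sum.delta' finite_set_label_pmf set_pmf_iff)
  finally show ?thesis .
qed

subsection \<open>Moving a vertex to another community\<close>

text \<open>Vertices \<open>1, ..., m\<close> form the block whose members may move from
  \<open>i\<close> to \<open>j\<close>. The bound \<open>q < 1\<close> keeps the denominators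
  \<open>1 - q * affinity\<close> positive.\<close>

locale label_swap =
  fixes P :: "real ^ 'k ^ 'k::finite" and i j :: 'k and \<xi> q :: real and m n :: nat
  assumes P: "\<And>r s. 0 < P $ r $ s" "\<And>r s. P $ r $ s < 1"
    and \<xi>: "0 < \<xi>" "\<xi> < 1" and q: "0 \<le> q" "q < 1" and mn: "m \<le> n" and ij: "i \<noteq> j"
begin

text \<open>For \<open>v \<le> m < u\<close>, the pair \<open>(v, u)\<close> is increasing, as required by \<^const>\<open>vertex_pairs\<close>.\<close>

definition llr :: "(nat \<Rightarrow> 'k) \<Rightarrow> nat \<Rightarrow> observed_graph \<Rightarrow> real" where
  "llr \<sigma> v G = (\<Sum>u\<in>{m<..n}. log_ratio (P $ i $ \<sigma> u) (P $ j $ \<sigma> u) (G (v, u)))"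

definition balanced :: "real \<Rightarrow> (nat \<Rightarrow> 'k) \<Rightarrow> nat \<Rightarrow> observed_graph set" where
  "balanced c \<sigma> v = {G. \<bar>llr \<sigma> v G\<bar> \<le> c}"

definition inner_pairs :: "nat \<Rightarrow> (nat \<times> nat) set" where
  "inner_pairs v = {e \<in> vertex_pairs m. fst e = v \<or> snd e = v}"

definition touched :: "nat \<Rightarrow> observed_graph set" where
  "touched v = {G. \<exists>e\<in>inner_pairs v. G e \<noteq> Censored}"

definition swappable :: "real \<Rightarrow> (nat \<Rightarrow> 'k) \<Rightarrow> observed_graph \<Rightarrow> nat set" where
  "swappable c \<sigma> G = {v \<in> {1..m}. \<sigma> v = i \<and> G \<in> balanced c \<sigma> v - touched v}"

definition label_affinity :: "'k \<Rightarrow> real" where "label_affinity r = affinity \<xi> (P $ i $ r) (P $ j $ r)"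
definition label_drift :: "'k \<Rightarrow> real" where "label_drift r = drift \<xi> (P $ i $ r) (P $ j $ r)"
definition label_spread :: "'k \<Rightarrow> real" where "label_spread r = spread \<xi> (P $ i $ r) (P $ j $ r)"

section \<open>Probability that a vertex can be moved\<close>

lemma llr_cong: "(\<And>e. e \<in> {v} \<times> {m<..n} \<Longrightarrow> G e = H e) \<Longrightarrow> llr \<sigma> v G = llr \<sigma> v H"
  unfolding llr_def by (intro sum.cong) auto

lemma outer_subset: "v \<in> {1..m} \<Longrightarrow> {v} \<times> {m<..n} \<subseteq> vertex_pairs n"
  by (auto simp: vertex_pairs_def)

lemma inner_subset: "inner_pairs v \<subseteq> vertex_pairs n"
  using mn by (auto simp: vertex_pairs_def inner_pairs_def)

lemma inner_outer_disjoint: "({v} \<times> {m<..n}) \<inter> inner_pairs w = {}"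
  by (auto simp: vertex_pairs_def inner_pairs_def)

lemma prob_balanced_Int:
  assumes "v \<in> {1..m}" "w \<in> {1..m}" "v \<noteq> w"
  shows "measure_pmf.prob (graph_pmf n P q \<sigma>) (balanced c \<sigma> v \<inter> balanced c \<sigma> w)
    = measure_pmf.prob (graph_pmf n P q \<sigma>) (balanced c \<sigma> v) * measure_pmf.prob (graph_pmf n P q \<sigma>) (balanced c \<sigma> w)"
  unfolding graph_pmf_def balanced_def
  by (rule prob_Pi_pmf_indep[where A\<^sub>1 = "{v} \<times> {m<..n}" and A\<^sub>2 = "{w} \<times> {m<..n}"])
     (use assms outer_subset in \<open>auto simp: finite_set_status_pmf cong: llr_cong\<close>)

lemma card_inner_pairs: "card (inner_pairs v) \<le> m"
proof -
  \<comment> \<open>An inner pair is determined by its other endpoint; \<open>min\<close> and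
    \<open>max\<close> restore the increasing order.\<close>
  have "inner_pairs v \<subseteq> (\<lambda>w. (min v w, max v w)) ` {1..m}"
  proof
    fix e assume e: "e \<in> inner_pairs v"
    define w where "w = (if fst e = v then snd e else fst e)"
    have "e = (min v w, max v w)" "w \<in> {1..m}"
      using e by (auto simp: inner_pairs_def vertex_pairs_def w_def)
    then show "e \<in> (\<lambda>w. (min v w, max v w)) ` {1..m}" by blast
  qed
  then have "card (inner_pairs v) \<le> card ((\<lambda>w. (min v w, max v w)) ` {1..m})"
    by (intro card_mono) auto
  also have "\<dots> \<le> m" using card_image_le[of "{1..m}"] by fastforce
  finally show ?thesis .
qed

text \<open>Union bound: each pair is revealed with probability exactly \<open>q\<close>, whatever
  the communities of its endpoints.\<close>

lemma prob_touched_le: "measure_pmf.prob (graph_pmf n P q \<sigma>) (touched v) \<le> real m * q"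
proof -
  let ?M = "graph_pmf n P q \<sigma>"
  have fin: "finite (inner_pairs v)" using inner_subset finite_subset by fastforce
  have one: "measure_pmf.prob ?M {G. G e \<in> - {Censored}} = q" if e: "e \<in> inner_pairs v" for e
  proof -
    obtain a b where ab: "e = (a, b)" by force
    have "measure_pmf.prob ?M {G. G e \<in> - {Censored}} = measure_pmf.prob (status_pmf (P $ \<sigma> a $ \<sigma> b) q) (- {Censored})"
      unfolding graph_pmf_def using e inner_subset by (subst prob_Pi_pmf_component) (auto simp: ab)
    also have "\<dots> = 1 - pmf (status_pmf (P $ \<sigma> a $ \<sigma> b) q) Censored"
      using measure_pmf.prob_compl[of "{Censored}" "status_pmf (P $ \<sigma> a $ \<sigma> b) q"]
      by (simp add: Compl_eq_Diff_UNIV measure_pmf_single)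
    also have "\<dots> = q" using P q by (simp add: pmf_status_pmf less_imp_le)
    finally show ?thesis .
  qed
  have "touched v = (\<Union>e\<in>inner_pairs v. {G. G e \<in> - {Censored}})" by (auto simp: touched_def)
  then have "measure_pmf.prob ?M (touched v) \<le> (\<Sum>e\<in>inner_pairs v. measure_pmf.prob ?M {G. G e \<in> - {Censored}})"
    using measure_pmf.finite_measure_subadditive_finite[OF fin, of "\<lambda>e. {G. G e \<in> - {Censored}}" ?M] by simp
  also have "\<dots> = real (card (inner_pairs v)) * q" by (simp add: one del: Compl_iff)
  also have "\<dots> \<le> real m * q" using card_inner_pairs q by (intro mult_right_mono) auto
  finally show ?thesis .
qed

text \<open>The two events depend on disjoint sets of pairs, outer and inner ones. This supplies the
  relative loss \<open>\<kappa> = real m * q\<close> in \<open>prob_card_good_small\<close>.\<close>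

lemma prob_balanced_touched_le:
  assumes "v \<in> {1..m}"
  shows "measure_pmf.prob (graph_pmf n P q \<sigma>) (balanced c \<sigma> v \<inter> touched v)
    \<le> measure_pmf.prob (graph_pmf n P q \<sigma>) (balanced c \<sigma> v) * (real m * q)"
proof -
  have "measure_pmf.prob (graph_pmf n P q \<sigma>) (balanced c \<sigma> v \<inter> touched v)
    = measure_pmf.prob (graph_pmf n P q \<sigma>) (balanced c \<sigma> v) * measure_pmf.prob (graph_pmf n P q \<sigma>) (touched v)"
    unfolding graph_pmf_def
  proof (rule prob_Pi_pmf_indep[where A\<^sub>1 = "{v} \<times> {m<..n}" and A\<^sub>2 = "inner_pairs v"])
    show "G \<in> balanced c \<sigma> v \<Longrightarrow> H \<in> balanced c \<sigma> v"
      if "\<And>e. e \<in> {v} \<times> {m<..n} \<Longrightarrow> G e = H e" for G H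
      using llr_cong[of v G H \<sigma>] that by (simp add: balanced_def)
    show "G \<in> touched v \<Longrightarrow> H \<in> touched v" if "\<And>e. e \<in> inner_pairs v \<Longrightarrow> G e = H e" for G H
      using that by (auto simp: touched_def)
  qed (use outer_subset[OF assms] inner_subset inner_outer_disjoint in \<open>auto simp: finite_set_status_pmf\<close>)
  also have "\<dots> \<le> measure_pmf.prob (graph_pmf n P q \<sigma>) (balanced c \<sigma> v) * (real m * q)"
    by (intro mult_left_mono prob_touched_le) auto
  finally show ?thesis .
qed

lemma prob_swappable_small:
  assumes p: "p > 0" and I: "{v \<in> {1..m}. \<sigma> v = i} \<noteq> {}"
    and lower: "\<And>v. v \<in> {1..m} \<Longrightarrow> \<sigma> v = i \<Longrightarrow> p \<le> measure_pmf.prob (graph_pmf n P q \<sigma>) (balanced c \<sigma> v)"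
  shows "measure_pmf.prob (graph_pmf n P q \<sigma>)
      {G. real (card (swappable c \<sigma> G)) < real (card {v \<in> {1..m}. \<sigma> v = i}) * p / 4}
    \<le> 4 / (real (card {v \<in> {1..m}. \<sigma> v = i}) * p) + 4 * (real m * q)"
proof -
  let ?I = "{v \<in> {1..m}. \<sigma> v = i}"
  have "swappable c \<sigma> G = {v \<in> ?I. G \<in> balanced c \<sigma> v - touched v}" for G
    by (auto simp: swappable_def)
  then show ?thesis
    using prob_card_good_small[OF finite_set_graph_pmf, of ?I n P q \<sigma> "balanced c \<sigma>" touched "real m * q" p]
      prob_balanced_Int prob_balanced_touched_le p I lower by simp
qed

text \<open>Under the tilted law the ratio has the sum of the drifts as mean, so Chebyshev applies
  with the margin left below \<open>c\<close>. Returning to the original law costs the product of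
  prefactors and \<open>exp (- c)\<close>.\<close>

lemma prob_balanced_lower:
  assumes v: "v \<in> {1..m}" "\<sigma> v = i" and c: "0 \<le> c" "\<bar>\<Sum>u\<in>{m<..n}. q * label_drift (\<sigma> u)\<bar> < c"
  shows "(\<Prod>u\<in>{m<..n}. (1 - q) / (1 - q * label_affinity (\<sigma> u))) * exp (- c)
      * (1 - (\<Sum>u\<in>{m<..n}. q * label_spread (\<sigma> u)) / (c - \<bar>\<Sum>u\<in>{m<..n}. q * label_drift (\<sigma> u)\<bar>)\<^sup>2)
    \<le> measure_pmf.prob (graph_pmf n P q \<sigma>) (balanced c \<sigma> v)"
proof -
  let ?S = "{v} \<times> {m<..n}"
  define p where "p = (\<lambda>(a, b). status_pmf (P $ \<sigma> a $ \<sigma> b) q)"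
  \<comment> \<open>Only the outer pairs at \<open>v\<close> are tilted. Elsewhere
    \<open>p'\<close>, \<open>z\<close> and \<open>L\<close> are neutral, so products and sums over
    all pairs collapse to \<open>?S\<close>.\<close>
  define p' where "p' = (\<lambda>e. if e \<in> ?S then tilted_pmf \<xi> (P $ i $ \<sigma> (snd e)) (P $ j $ \<sigma> (snd e)) q else p e)"
  define z where "z = (\<lambda>e. if e \<in> ?S then (1 - q) / (1 - q * label_affinity (\<sigma> (snd e))) else 1)"
  define L where "L = (\<lambda>e y. if e \<in> ?S then (1 - \<xi>) * log_ratio (P $ i $ \<sigma> (snd e)) (P $ j $ \<sigma> (snd e)) y else 0)"
  define M where "M = Pi_pmf (vertex_pairs n) Censored p'"
  define X where "X = (\<lambda>u G. log_ratio (P $ i $ \<sigma> u) (P $ j $ \<sigma> u) (G (v, u)))"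
  have graph: "graph_pmf n P q \<sigma> = Pi_pmf (vertex_pairs n) Censored p"
    by (simp add: graph_pmf_def p_def)
  have sub: "?S \<subseteq> vertex_pairs n" using outer_subset[OF v(1)] .
  have q1: "q \<le> 1" using q by simp
  have M: "finite (set_pmf M)"
    unfolding M_def by (intro finite_set_Pi_pmf) (auto simp: finite_set_status_pmf)
  have A1: "label_affinity r \<le> 1" "0 < label_affinity r" for r unfolding label_affinity_def using affinity_le_1 affinity_pos P \<xi> by auto
  have zA: "0 \<le> (1 - q) / (1 - q * label_affinity r)" for r
    using q A1[of r] mult_le_one[of q "label_affinity r"] by (intro divide_nonneg_nonneg) auto
  have "(\<Prod>e\<in>vertex_pairs n. z e) = (\<Prod>e\<in>?S. z e)"
    using sub by (intro prod.mono_neutral_right) (auto simp: z_def)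
  also have "\<dots> = (\<Prod>u\<in>{m<..n}. (1 - q) / (1 - q * label_affinity (\<sigma> u)))"
    by (rule prod.reindex_bij_witness[of _ "Pair v" snd]) (auto simp: z_def)
  finally have prodz: "(\<Prod>e\<in>vertex_pairs n. z e) = (\<Prod>u\<in>{m<..n}. (1 - q) / (1 - q * label_affinity (\<sigma> u)))" .
  have sumL: "(\<Sum>e\<in>vertex_pairs n. L e (G e)) = (1 - \<xi>) * llr \<sigma> v G" for G
  proof -
    have "(\<Sum>e\<in>vertex_pairs n. L e (G e)) = (\<Sum>e\<in>?S. L e (G e))"
      using sub by (intro sum.mono_neutral_right) (auto simp: L_def)
    also have "\<dots> = (\<Sum>u\<in>{m<..n}. (1 - \<xi>) * log_ratio (P $ i $ \<sigma> u) (P $ j $ \<sigma> u) (G (v, u)))"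
      by (rule sum.reindex_bij_witness[of _ "Pair v" snd]) (auto simp: L_def)
    finally show ?thesis by (simp add: llr_def sum_distrib_left)
  qed
  have change: "(\<Prod>e\<in>vertex_pairs n. z e) * exp (- c) * measure_pmf.prob M (balanced c \<sigma> v)
      \<le> measure_pmf.prob (graph_pmf n P q \<sigma>) (balanced c \<sigma> v)"
    unfolding graph M_def
  proof (rule prob_Pi_pmf_tilt[where L = L])
    show "0 \<le> z e" for e using zA by (simp add: z_def)
    show "z e * exp (- L e y) * pmf (p' e) y \<le> pmf (p e) y" for e y
      using tilted_pmf_le_status_pmf[of "P $ i $ \<sigma> (snd e)" "P $ j $ \<sigma> (snd e)" \<xi> q y] P \<xi> q v
      by (auto simp: z_def L_def p'_def p_def label_affinity_def)
    show "(\<Sum>e\<in>vertex_pairs n. L e (G e)) \<le> c" if "G \<in> balanced c \<sigma> v" for G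
    proof -
      have "(1 - \<xi>) * llr \<sigma> v G \<le> (1 - \<xi>) * c"
        using that \<xi> by (intro mult_left_mono) (auto simp: balanced_def)
      also have "\<dots> \<le> c" using \<xi> c by (intro mult_left_le_one_le) auto
      finally show ?thesis by (simp add: sumL)
    qed
  qed (auto simp: finite_set_status_pmf)
  have comp: "measure_pmf.expectation M (\<lambda>G. h (G (v, u)))
      = measure_pmf.expectation (tilted_pmf \<xi> (P $ i $ \<sigma> u) (P $ j $ \<sigma> u) q) h"
    if "u \<in> {m<..n}" for u and h :: "status \<Rightarrow> real"
    unfolding M_def using that sub by (subst expectation_Pi_pmf_component) (auto simp: p'_def)
  have EX: "measure_pmf.expectation M (X u) = q * label_drift (\<sigma> u)" if "u \<in> {m<..n}" for u
    unfolding X_def using that P \<xi> q1 q by (subst comp) (auto simp: label_drift_def expectation_tilted_pmf)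
  have EX2: "measure_pmf.expectation M (\<lambda>G. (X u G)\<^sup>2) = q * label_spread (\<sigma> u)" if "u \<in> {m<..n}" for u
    unfolding X_def using that P \<xi> q1 q
    by (subst comp[where h = "\<lambda>y. (log_ratio _ _ y)\<^sup>2"]) (auto simp: label_spread_def expectation_tilted_pmf)
  have uncor: "measure_pmf.expectation M (\<lambda>G. X u G * X w G)
      = measure_pmf.expectation M (X u) * measure_pmf.expectation M (X w)"
    if "u \<in> {m<..n}" "w \<in> {m<..n}" "u \<noteq> w" for u w
    unfolding M_def
    by (rule expectation_Pi_pmf_indep[where A\<^sub>1 = "{(v, u)}" and A\<^sub>2 = "{(v, w)}"])
       (use that sub in \<open>auto simp: X_def finite_set_status_pmf\<close>)
  define d where "d = (\<Sum>u\<in>{m<..n}. q * label_drift (\<sigma> u))"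
  have pos: "0 < c - \<bar>d\<bar>" using c by (simp add: d_def)
  have "measure_pmf.prob M {G. c - \<bar>d\<bar> \<le> \<bar>(\<Sum>u\<in>{m<..n}. X u G) - d\<bar>}
     \<le> (\<Sum>u\<in>{m<..n}. q * label_spread (\<sigma> u)) / (c - \<bar>d\<bar>)\<^sup>2"
    using chebyshev_uncorrelated[OF M _ pos, of "{m<..n}" X] uncor by (simp add: EX EX2 d_def)
  \<comment> \<open>Triangle inequality: a ratio exceeding \<open>c\<close> in absolute value is at
    distance at least \<open>c - \<bar>d\<bar>\<close> from its mean \<open>d\<close>.\<close>
  moreover have "- balanced c \<sigma> v \<subseteq> {G. c - \<bar>d\<bar> \<le> \<bar>(\<Sum>u\<in>{m<..n}. X u G) - d\<bar>}"
    by (auto simp: balanced_def llr_def X_def)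
  then have "measure_pmf.prob M (- balanced c \<sigma> v) \<le> measure_pmf.prob M {G. c - \<bar>d\<bar> \<le> \<bar>(\<Sum>u\<in>{m<..n}. X u G) - d\<bar>}"
    by (intro measure_pmf.finite_measure_mono) auto
  moreover have "measure_pmf.prob M (- balanced c \<sigma> v) = 1 - measure_pmf.prob M (balanced c \<sigma> v)"
    using measure_pmf.prob_compl[of "balanced c \<sigma> v" M] by (simp add: Compl_eq_Diff_UNIV)
  ultimately have "1 - (\<Sum>u\<in>{m<..n}. q * label_spread (\<sigma> u)) / (c - \<bar>d\<bar>)\<^sup>2 \<le> measure_pmf.prob M (balanced c \<sigma> v)"
    by linarith
  then have "(\<Prod>e\<in>vertex_pairs n. z e) * exp (- c) * (1 - (\<Sum>u\<in>{m<..n}. q * label_spread (\<sigma> u)) / (c - \<bar>d\<bar>)\<^sup>2)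
     \<le> (\<Prod>e\<in>vertex_pairs n. z e) * exp (- c) * measure_pmf.prob M (balanced c \<sigma> v)"
    using zA by (intro mult_left_mono mult_nonneg_nonneg prod_nonneg) (auto simp: z_def)
  with change show ?thesis unfolding prodz d_def by linarith
qed

text \<open>Only pairs at \<open>v\<close> change their law. Inner ones are censored, an event of
  probability \<open>1 - q\<close> under either label, and each outer one contributes its likelihood
  ratio.\<close>

lemma pmf_graph_swap:
  assumes v: "v \<in> {1..m}" "\<sigma> v = i" and G: "G \<notin> touched v"
  shows "pmf (graph_pmf n P q (\<sigma>(v := j))) G = exp (llr \<sigma> v G) * pmf (graph_pmf n P q \<sigma>) G"
proof (cases "\<forall>e. e \<notin> vertex_pairs n \<longrightarrow> G e = Censored")
  case True
  let ?S = "{v} \<times> {m<..n}"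
  let ?f = "\<lambda>e. if e \<in> ?S then exp (log_ratio (P $ i $ \<sigma> (snd e)) (P $ j $ \<sigma> (snd e)) (G e)) else 1"
  have sub: "?S \<subseteq> vertex_pairs n" using outer_subset[OF v(1)] .
  have "(\<Prod>e\<in>vertex_pairs n. ?f e) = (\<Prod>e\<in>?S. ?f e)"
    using sub by (intro prod.mono_neutral_right) auto
  also have "\<dots> = (\<Prod>u\<in>{m<..n}. exp (log_ratio (P $ i $ \<sigma> u) (P $ j $ \<sigma> u) (G (v, u))))"
    by (rule prod.reindex_bij_witness[of _ "Pair v" snd]) auto
  also have "\<dots> = exp (llr \<sigma> v G)" by (simp add: llr_def exp_sum)
  finally have prodf: "(\<Prod>e\<in>vertex_pairs n. ?f e) = exp (llr \<sigma> v G)" .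
  have factor: "pmf (status_pmf (P $ (\<sigma>(v := j)) a $ (\<sigma>(v := j)) b) q) (G (a, b))
      = ?f (a, b) * pmf (status_pmf (P $ \<sigma> a $ \<sigma> b) q) (G (a, b))"
    if e: "(a, b) \<in> vertex_pairs n" for a b
  proof (cases "(a, b) \<in> ?S")
    case True
    then have "a = v" "b \<noteq> v" using v by auto
    then show ?thesis
      using True v pmf_status_pmf_log_ratio[of "P $ i $ \<sigma> b" "P $ j $ \<sigma> b" \<xi> q "G (a, b)"] P \<xi> q by simp
  next
    case False
    show ?thesis
    proof (cases "a = v \<or> b = v")
      case True
      \<comment> \<open>As \<open>v \<le> m\<close>, a pair at \<open>v\<close> that does not lead
        out of the block as \<open>(v, u)\<close> with \<open>m < u\<close> has both endpoints in
        the block.\<close>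
      then have "(a, b) \<in> inner_pairs v"
        using False e v by (auto simp: inner_pairs_def vertex_pairs_def)
      then have "G (a, b) = Censored" using G by (auto simp: touched_def)
      then show ?thesis using False P q by (auto simp: pmf_status_pmf less_imp_le)
    next
      case nv: False
      then show ?thesis using False by simp
    qed
  qed
  have "pmf (graph_pmf n P q (\<sigma>(v := j))) G
     = (\<Prod>(a, b)\<in>vertex_pairs n. ?f (a, b) * pmf (status_pmf (P $ \<sigma> a $ \<sigma> b) q) (G (a, b)))"
    using True unfolding graph_pmf_def
    by (subst pmf_Pi') (auto intro!: prod.cong simp: factor simp del: fun_upd_apply)
  also have "\<dots> = (\<Prod>e\<in>vertex_pairs n. ?f e) * (\<Prod>(a, b)\<in>vertex_pairs n. pmf (status_pmf (P $ \<sigma> a $ \<sigma> b) q) (G (a, b)))"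
    by (simp only: prod.distrib[symmetric] case_prod_unfold prod.collapse)
  also have "(\<Prod>(a, b)\<in>vertex_pairs n. pmf (status_pmf (P $ \<sigma> a $ \<sigma> b) q) (G (a, b))) = pmf (graph_pmf n P q \<sigma>) G"
    using True unfolding graph_pmf_def by (subst pmf_Pi') (auto intro!: prod.cong)
  finally show ?thesis by (simp only: prodf)
next
  case False
  then have "pmf (graph_pmf n P q \<tau>) G = 0" for \<tau>
    unfolding graph_pmf_def by (intro pmf_Pi_outside) auto
  then show ?thesis by simp
qed

end

subsection \<open>Typical labellings\<close>

lemma sum_over_labels:
  fixes F :: "'k::finite \<Rightarrow> real"
  assumes "finite S"
  shows "(\<Sum>u\<in>S. F (\<sigma> u)) = (\<Sum>r\<in>UNIV. real (card {u \<in> S. \<sigma> u = r}) * F r)"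
proof -
  have "(\<Sum>u\<in>S. F (\<sigma> u)) = (\<Sum>r\<in>UNIV. \<Sum>u\<in>{u \<in> S. \<sigma> u = r}. F (\<sigma> u))"
    using assms by (intro sum.group[symmetric]) auto
  also have "\<dots> = (\<Sum>r\<in>UNIV. real (card {u \<in> S. \<sigma> u = r}) * F r)"
    by (intro sum.cong) auto
  finally show ?thesis .
qed

lemma sum_over_labels_approx:
  fixes F :: "'k::finite \<Rightarrow> real"
  assumes "finite S" and c: "\<And>r. \<bar>real (card {u \<in> S. \<sigma> u = r}) - \<rho> $ r * n\<bar> \<le> \<eta> * n"
  shows "\<bar>(\<Sum>u\<in>S. F (\<sigma> u)) - n * (\<Sum>r\<in>UNIV. \<rho> $ r * F r)\<bar> \<le> \<eta> * n * (\<Sum>r\<in>UNIV. \<bar>F r\<bar>)"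
proof -
  have "(\<Sum>u\<in>S. F (\<sigma> u)) - n * (\<Sum>r\<in>UNIV. \<rho> $ r * F r)
     = (\<Sum>r\<in>UNIV. (real (card {u \<in> S. \<sigma> u = r}) - \<rho> $ r * n) * F r)"
    using assms(1) by (simp add: sum_over_labels sum_distrib_left sum_subtractf algebra_simps)
  also have "\<bar>\<dots>\<bar> \<le> (\<Sum>r\<in>UNIV. \<eta> * n * \<bar>F r\<bar>)"
    by (rule order_trans[OF sum_abs]) (auto simp: abs_mult intro!: sum_mono mult_right_mono c)
  finally show ?thesis by (simp add: sum_distrib_left)
qed

context
  fixes \<rho> :: "real ^ 'k::finite"
  assumes \<rho>: "\<And>r. 0 < \<rho> $ r" "(\<Sum>r\<in>UNIV. \<rho> $ r) = 1"
begin

lemma prior_le_1: "\<rho> $ r \<le> 1"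
  using member_le_sum[of r UNIV "\<lambda>r. \<rho> $ r"] \<rho> by (simp add: less_imp_le)

lemma pmf_community: "pmf (community_pmf \<rho>) r = \<rho> $ r"
  using \<rho> by (intro pmf_community_pmf) (auto intro: less_imp_le)

lemma label_count_concentration:
  assumes S: "S \<subseteq> {1..n}" and a: "a > 0"
  shows "measure_pmf.prob (label_pmf n \<rho>) {\<sigma>. a \<le> \<bar>real (card {u \<in> S. \<sigma> u = r}) - \<rho> $ r * real (card S)\<bar>}
    \<le> real (card S) / a\<^sup>2"
proof -
  define X where "X = (\<lambda>u (\<sigma> :: nat \<Rightarrow> 'k). of_bool (\<sigma> u = r) :: real)"
  let ?M = "label_pmf n \<rho>"
  have fin: "finite S" using S finite_subset by blast
  have single: "measure_pmf.expectation (community_pmf \<rho>) (\<lambda>y. of_bool (y = r)) = \<rho> $ r"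
    using integral_measure_pmf_real[of "{r}" "community_pmf \<rho>" "\<lambda>y. of_bool (y = r)"]
    by (simp add: pmf_community split: if_splits)
  have EX: "measure_pmf.expectation ?M (X u) = \<rho> $ r" if "u \<in> S" for u
    unfolding X_def label_pmf_def using that S single
    by (subst expectation_Pi_pmf_component[where h = "\<lambda>y. of_bool (y = r)"]) auto
  have sq: "(\<lambda>\<sigma>. (X u \<sigma>)\<^sup>2) = X u" for u by (auto simp: X_def)
  have uncor: "measure_pmf.expectation ?M (\<lambda>\<sigma>. X u \<sigma> * X w \<sigma>)
      = measure_pmf.expectation ?M (X u) * measure_pmf.expectation ?M (X w)"
    if "u \<in> S" "w \<in> S" "u \<noteq> w" for u w
    unfolding label_pmf_def
    by (rule expectation_Pi_pmf_indep[where A\<^sub>1 = "{u}" and A\<^sub>2 = "{w}"])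
       (use that S in \<open>auto simp: X_def\<close>)
  have count: "(\<Sum>u\<in>S. X u \<sigma>) = real (card {u \<in> S. \<sigma> u = r})" for \<sigma>
    using fin by (simp add: X_def Int_def)
  have "measure_pmf.prob ?M {\<sigma>. a \<le> \<bar>(\<Sum>u\<in>S. X u \<sigma>) - (\<Sum>u\<in>S. measure_pmf.expectation ?M (X u))\<bar>}
     \<le> (\<Sum>u\<in>S. measure_pmf.expectation ?M (\<lambda>\<sigma>. (X u \<sigma>)\<^sup>2)) / a\<^sup>2"
    by (rule chebyshev_uncorrelated[OF finite_set_label_pmf fin a uncor])
  also have "(\<Sum>u\<in>S. measure_pmf.expectation ?M (\<lambda>\<sigma>. (X u \<sigma>)\<^sup>2)) = (\<Sum>u\<in>S. \<rho> $ r)"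
    unfolding sq by (intro sum.cong) (auto simp: EX)
  also have "\<dots> / a\<^sup>2 \<le> real (card S) / a\<^sup>2"
    using prior_le_1[of r] by (intro divide_right_mono) (auto intro: mult_left_le)
  finally show ?thesis by (simp add: count EX mult.commute)
qed

text \<open>Counts outside the block are compared with \<open>\<rho> $ r * real n\<close> rather
  than with the slightly smaller expectation, so that averages come out normalized by
  \<open>n\<close>; \<open>\<eta>\<close> absorbs the difference.\<close>

definition typical :: "nat \<Rightarrow> nat \<Rightarrow> real \<Rightarrow> 'k \<Rightarrow> (nat \<Rightarrow> 'k) \<Rightarrow> bool" where
  "typical m n \<eta> i \<sigma> \<longleftrightarrow> (\<forall>r. \<bar>real (card {u \<in> {m<..n}. \<sigma> u = r}) - \<rho> $ r * real n\<bar> \<le> \<eta> * real n)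
     \<and> \<rho> $ i * real m / 2 \<le> real (card {v \<in> {1..m}. \<sigma> v = i})"

text \<open>Replacing \<open>n\<close> by the true number \<open>n - m\<close> of outer vertices
  shifts each centre by at most \<open>m\<close>, which leaves a deviation of
  \<open>\<eta> * real n - real m\<close> for Chebyshev in each community.\<close>

lemma prob_not_typical_le:
  assumes m: "0 < m" "m \<le> n" "real m < \<eta> * real n"
  shows "measure_pmf.prob (label_pmf n \<rho>) {\<sigma>. \<not> typical m n \<eta> i \<sigma>}
    \<le> real CARD('k) * (real n / (\<eta> * real n - real m)\<^sup>2) + 4 / ((\<rho> $ i)\<^sup>2 * real m)"
proof -
  let ?M = "label_pmf n \<rho>"
  define B where "B = (\<lambda>r :: 'k. {\<sigma>. \<eta> * real n - real m
    \<le> \<bar>real (card {u \<in> {m<..n}. \<sigma> u = r}) - \<rho> $ r * real (card {m<..n})\<bar>})"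
  define B' where "B' = {\<sigma> :: nat \<Rightarrow> 'k. \<rho> $ i * real m / 2
    \<le> \<bar>real (card {v \<in> {1..m}. \<sigma> v = i}) - \<rho> $ i * real (card {1..m})\<bar>}"
  have B: "measure_pmf.prob ?M (B r) \<le> real n / (\<eta> * real n - real m)\<^sup>2" for r
  proof -
    have "measure_pmf.prob ?M (B r) \<le> real (card {m<..n}) / (\<eta> * real n - real m)\<^sup>2"
      unfolding B_def using m by (intro label_count_concentration) auto
    also have "\<dots> \<le> real n / (\<eta> * real n - real m)\<^sup>2"
      by (intro divide_right_mono) auto
    finally show ?thesis .
  qed
  have "measure_pmf.prob ?M B' \<le> real (card {1..m}) / (\<rho> $ i * real m / 2)\<^sup>2"
    unfolding B'_def using m \<rho>(1)[of i] by (intro label_count_concentration) auto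
  also have "\<dots> = 4 / ((\<rho> $ i)\<^sup>2 * real m)"
    using m \<rho>(1)[of i] by (simp add: power2_eq_square field_simps)
  finally have B': "measure_pmf.prob ?M B' \<le> 4 / ((\<rho> $ i)\<^sup>2 * real m)" .
  have "{\<sigma>. \<not> typical m n \<eta> i \<sigma>} \<subseteq> (\<Union>r. B r) \<union> B'"
  proof
    fix \<sigma> assume "\<sigma> \<in> {\<sigma>. \<not> typical m n \<eta> i \<sigma>}"
    then consider r where "\<eta> * real n < \<bar>real (card {u \<in> {m<..n}. \<sigma> u = r}) - \<rho> $ r * real n\<bar>"
      | "real (card {v \<in> {1..m}. \<sigma> v = i}) < \<rho> $ i * real m / 2"
      by (force simp: typical_def not_le)
    then show "\<sigma> \<in> (\<Union>r. B r) \<union> B'"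
    proof cases
      case 1
      have "\<rho> $ r * real m \<le> real m" "0 \<le> \<rho> $ r * real m"
        using prior_le_1[of r] \<rho>(1)[of r] by (auto intro: mult_left_le_one_le)
      then have "\<eta> * real n - real m
          \<le> \<bar>real (card {u \<in> {m<..n}. \<sigma> u = r}) - \<rho> $ r * (real n - real m)\<bar>"
        using 1 unfolding right_diff_distrib by linarith
      then have "\<sigma> \<in> B r" using m by (simp add: B_def of_nat_diff)
      then show ?thesis by blast
    next
      case 2
      then have "\<sigma> \<in> B'" by (auto simp: B'_def mult.commute)
      then show ?thesis by blast
    qed
  qed
  then have "measure_pmf.prob ?M {\<sigma>. \<not> typical m n \<eta> i \<sigma>} \<le> measure_pmf.prob ?M (\<Union>r. B r) + measure_pmf.prob ?M B'"
    by (intro order_trans[OF measure_pmf.finite_measure_mono measure_subadditive]) auto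
  also have "measure_pmf.prob ?M (\<Union>r. B r) \<le> (\<Sum>r\<in>UNIV. measure_pmf.prob ?M (B r))"
    by (intro measure_pmf.finite_measure_subadditive_finite) auto
  also have "\<dots> \<le> real CARD('k) * (real n / (\<eta> * real n - real m)\<^sup>2)"
    using sum_mono[of UNIV "\<lambda>r. measure_pmf.prob ?M (B r)", OF B] by simp
  finally show ?thesis using B' by linarith
qed

text \<open>Only the factor at \<open>v\<close> changes. As \<open>v\<close> lies in
  \<open>{1..n}\<close>, both labellings satisfy or violate the default condition together.\<close>

lemma pmf_label_swap:
  assumes v: "v \<in> {1..n}" "\<sigma> v = i"
  shows "\<rho> $ i * pmf (label_pmf n \<rho>) (\<sigma>(v := j)) = \<rho> $ j * pmf (label_pmf n \<rho>) \<sigma>"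
proof (cases "\<forall>u. u \<notin> {1..n} \<longrightarrow> \<sigma> u = undefined")
  case True
  have "\<rho> $ i * pmf (label_pmf n \<rho>) (\<sigma>(v := j)) = \<rho> $ i * (\<Prod>u\<in>{1..n}. \<rho> $ ((\<sigma>(v := j)) u))"
    using True v unfolding label_pmf_def by (subst pmf_Pi') (auto simp: pmf_community)
  also have "(\<Prod>u\<in>{1..n}. \<rho> $ ((\<sigma>(v := j)) u)) = \<rho> $ j * (\<Prod>u\<in>{1..n} - {v}. \<rho> $ \<sigma> u)"
    using v by (subst prod.remove[of _ v]) (auto intro!: prod.cong)
  also have "\<rho> $ i * (\<rho> $ j * (\<Prod>u\<in>{1..n} - {v}. \<rho> $ \<sigma> u))
      = \<rho> $ j * (\<rho> $ i * (\<Prod>u\<in>{1..n} - {v}. \<rho> $ \<sigma> u))"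
    by simp
  also have "\<dots> = \<rho> $ j * (\<Prod>u\<in>{1..n}. \<rho> $ \<sigma> u)"
    using v by (subst prod.remove[of "{1..n}" v]) auto
  also have "\<dots> = \<rho> $ j * pmf (label_pmf n \<rho>) \<sigma>"
    using True unfolding label_pmf_def by (subst pmf_Pi') (auto simp: pmf_community)
  finally show ?thesis .
next
  case False
  then have "pmf (label_pmf n \<rho>) \<sigma> = 0" "pmf (label_pmf n \<rho>) (\<sigma>(v := j)) = 0"
    unfolding label_pmf_def using v by (auto intro!: pmf_Pi_outside)
  then show ?thesis by simp
qed

end

subsection \<open>Non-asymptotic error bound\<close>

text \<open>The relabellings of \<open>\<sigma>\<close> at swappable vertices are distinct, share
  the graph \<open>G\<close>, and each has at least
  \<open>\<rho> $ j / \<rho> $ i * exp (- c)\<close> times the mass of \<open>\<sigma>\<close>.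
  Together they fit under the marginal of \<open>G\<close>.\<close>

lemma (in label_swap) pmf_CSBM_le_marginal:
  assumes \<rho>: "\<And>r. 0 < \<rho> $ r" "(\<Sum>r\<in>UNIV. \<rho> $ r) = 1"
    and qt: "q = t * ln (real n) / real n"
    and K: "K \<le> real (card (swappable c \<sigma> G))"
  shows "pmf (CSBM n \<rho> P t) (\<sigma>, G) * (K * (\<rho> $ j / \<rho> $ i * exp (- c)))
    \<le> pmf (map_pmf snd (CSBM n \<rho> P t)) G"
proof -
  let ?M = "CSBM n \<rho> P t" and ?B = "swappable c \<sigma> G"
  let ?f = "\<lambda>v. (\<sigma>(v := j), G)"
  have fin: "finite ?B" by (simp add: swappable_def)
  have inj: "inj_on ?f ?B"
  proof (rule inj_onI)
    fix v w assume vw: "v \<in> ?B" "w \<in> ?B" "?f v = ?f w"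
    then have "(\<sigma>(v := j)) v = (\<sigma>(w := j)) v" by (metis fst_conv)
    then show "v = w" using vw ij by (auto simp: swappable_def split: if_splits)
  qed
  have swap: "pmf ?M (\<sigma>, G) * (\<rho> $ j / \<rho> $ i * exp (- c)) \<le> pmf ?M (?f v)" if "v \<in> ?B" for v
  proof -
    have v: "v \<in> {1..m}" "\<sigma> v = i" "G \<notin> touched v" "- c \<le> llr \<sigma> v G"
      using that by (auto simp: swappable_def balanced_def)
    have "pmf (label_pmf n \<rho>) (\<sigma>(v := j)) = \<rho> $ j / \<rho> $ i * pmf (label_pmf n \<rho>) \<sigma>"
      using pmf_label_swap[OF \<rho>, of v n \<sigma> i j] v mn \<rho>(1)[of i] by (simp add: field_simps)
    moreover have "exp (- c) * pmf (graph_pmf n P q \<sigma>) G \<le> pmf (graph_pmf n P q (\<sigma>(v := j))) G"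
      using v by (subst pmf_graph_swap[of v \<sigma> G, OF v(1-3)]) (auto intro!: mult_right_mono)
    then have "\<rho> $ j / \<rho> $ i * pmf (label_pmf n \<rho>) \<sigma> * (exp (- c) * pmf (graph_pmf n P q \<sigma>) G)
       \<le> \<rho> $ j / \<rho> $ i * pmf (label_pmf n \<rho>) \<sigma> * pmf (graph_pmf n P q (\<sigma>(v := j))) G"
      using \<rho>(1)[of i] \<rho>(1)[of j] by (intro mult_left_mono) auto
    ultimately show ?thesis by (simp add: pmf_CSBM mult_ac flip: qt)
  qed
  have "pmf ?M (\<sigma>, G) * (K * (\<rho> $ j / \<rho> $ i * exp (- c)))
     \<le> real (card ?B) * (pmf ?M (\<sigma>, G) * (\<rho> $ j / \<rho> $ i * exp (- c)))"
    using K \<rho>(1)[of i] \<rho>(1)[of j] 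
    by (subst mult.left_commute) (intro mult_right_mono, auto intro!: mult_nonneg_nonneg divide_nonneg_nonneg less_imp_le)
  also have "\<dots> \<le> (\<Sum>v\<in>?B. pmf ?M (?f v))"
    using swap by (intro sum_bounded_below) auto
  also have "\<dots> = measure_pmf.prob ?M (?f ` ?B)"
    using fin inj by (simp add: measure_measure_pmf_finite sum.reindex)
  also have "\<dots> \<le> measure_pmf.prob ?M (snd -` {G})"
    by (intro measure_pmf.finite_measure_mono) auto
  also have "\<dots> = pmf (map_pmf snd ?M) G" by (simp add: pmf_map)
  finally show ?thesis .
qed

lemma (in label_swap) prob_exact_recovery_le:
  fixes est :: "'k estimator"
  assumes \<rho>: "\<And>r. 0 < \<rho> $ r" "(\<Sum>r\<in>UNIV. \<rho> $ r) = 1"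
    and qt: "q = t * ln (real n) / real n" and p: "0 < p" and m: "0 < m"
    and lower: "\<And>\<sigma> v. typical \<rho> m n \<eta> i \<sigma> \<Longrightarrow> v \<in> {1..m} \<Longrightarrow> \<sigma> v = i \<Longrightarrow>
      p \<le> measure_pmf.prob (graph_pmf n P q \<sigma>) (balanced c \<sigma> v)"
  shows "measure_pmf.prob (truth_estimate_pmf (CSBM n \<rho> P t) est) {(\<sigma>\<^sub>0, \<sigma>). exact_recovery n \<sigma>\<^sub>0 \<sigma>}
    \<le> measure_pmf.prob (label_pmf n \<rho>) {\<sigma>. \<not> typical \<rho> m n \<eta> i \<sigma>}
      + 8 / (\<rho> $ i * real m * p) + 4 * (real m * q)
      + 8 * real (card (UNIV :: ('k \<Rightarrow> 'k) set)) / (\<rho> $ j * (real m * p * exp (- c)))"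
proof -
  let ?M = "CSBM n \<rho> P t"
  \<comment> \<open>Typicality puts at least \<open>\<rho> $ i * real m / 2\<close> vertices of
    community \<open>i\<close> in the block, and \<open>prob_swappable_small\<close> retains a
    fraction \<open>p / 4\<close> of them.\<close>
  define K where "K = \<rho> $ i * real m * p / 8"
  define T where "T = {(\<sigma>, G). K \<le> real (card (swappable c \<sigma> G))}"
  define H where "H = K * (\<rho> $ j / \<rho> $ i * exp (- c))"
  define \<beta> where "\<beta> = 8 / (\<rho> $ i * real m * p) + 4 * (real m * q)"
  have K: "0 < K" using \<rho> p m by (simp add: K_def)
  have H: "0 < H" using K \<rho> by (simp add: H_def)
  have \<beta>: "0 \<le> \<beta>" using \<rho>(1)[of i] p q by (simp add: \<beta>_def)
  have supp: "\<sigma> u = undefined" if "\<sigma> \<in> fst ` set_pmf ?M" "u \<notin> {1..n}" for \<sigma> u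
  proof -
    have "\<sigma> \<in> set_pmf (label_pmf n \<rho>)" using that by (auto simp: CSBM_eq)
    then show ?thesis
      using that(2) set_Pi_pmf_subset[OF finite_atLeastAtMost, of 1 n undefined "\<lambda>_. community_pmf \<rho>"]
      unfolding label_pmf_def by blast
  qed
  have "measure_pmf.prob (truth_estimate_pmf ?M est) {(\<sigma>\<^sub>0, \<sigma>). exact_recovery n \<sigma>\<^sub>0 \<sigma>}
     \<le> measure_pmf.prob ?M (- T) + real (card (UNIV :: ('k \<Rightarrow> 'k) set)) / H"
    unfolding truth_estimate_pmf_def
  proof (rule prob_joint_le_posterior[OF finite_set_CSBM _ H])
    show "card {s \<in> fst ` set_pmf ?M. exact_recovery n s e} \<le> card (UNIV :: ('k \<Rightarrow> 'k) set)" for e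
      by (rule card_exact_recovery_le) (use supp in auto)
    show "pmf ?M (s, g) * H \<le> pmf (map_pmf snd ?M) g" if "(s, g) \<in> T" for s g
      unfolding H_def using that by (intro pmf_CSBM_le_marginal[OF \<rho> qt]) (auto simp: T_def)
  qed
  also have "real (card (UNIV :: ('k \<Rightarrow> 'k) set)) / H
     = 8 * real (card (UNIV :: ('k \<Rightarrow> 'k) set)) / (\<rho> $ j * (real m * p * exp (- c)))"
    using \<rho>(1)[of i] by (simp add: H_def K_def field_simps)
  also have "measure_pmf.prob ?M (- T) \<le> measure_pmf.prob (label_pmf n \<rho>) {\<sigma>. \<not> typical \<rho> m n \<eta> i \<sigma>} + \<beta>"
  proof -
    have vim: "Pair \<sigma> -` (- T) = {G. real (card (swappable c \<sigma> G)) < K}" for \<sigma>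
      by (auto simp: T_def not_le)
    \<comment> \<open>Atypical labellings are charged the trivial bound 1 through the indicator, so
      that the estimate can be averaged over the prior.\<close>
    have inner: "measure_pmf.prob (graph_pmf n P q \<sigma>) {G. real (card (swappable c \<sigma> G)) < K}
      \<le> indicator {\<sigma>. \<not> typical \<rho> m n \<eta> i \<sigma>} \<sigma> + \<beta>" for \<sigma>
    proof (cases "typical \<rho> m n \<eta> i \<sigma>")
      case True
      let ?I = "{v \<in> {1..m}. \<sigma> v = i}"
      have I: "\<rho> $ i * real m / 2 \<le> real (card ?I)"
        using True by (simp add: typical_def[OF \<rho>])
      have pos: "0 < \<rho> $ i * real m / 2" using \<rho> m by simp
      then have "?I \<noteq> {}" using I by (metis card.empty not_le of_nat_0)
      have KI: "K \<le> real (card ?I) * p / 4"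
        using mult_right_mono[OF I, of p] p by (simp add: K_def mult.commute)
      have "measure_pmf.prob (graph_pmf n P q \<sigma>) {G. real (card (swappable c \<sigma> G)) < K}
         \<le> measure_pmf.prob (graph_pmf n P q \<sigma>) {G. real (card (swappable c \<sigma> G)) < real (card ?I) * p / 4}"
        using KI by (intro measure_pmf.finite_measure_mono) auto
      also have "\<dots> \<le> 4 / (real (card ?I) * p) + 4 * (real m * q)"
        using prob_swappable_small[OF p \<open>?I \<noteq> {}\<close> lower[OF True]] .
      also have "4 / (real (card ?I) * p) \<le> 4 / (\<rho> $ i * real m / 2 * p)"
        using pos p less_le_trans[OF pos I] by (intro divide_left_mono mult_right_mono[OF I]) auto
      finally show ?thesis using True by (simp add: \<beta>_def)
    next
      case False
      then show ?thesis using \<beta> by (simp add: add_increasing2)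
    qed
    have "measure_pmf.prob ?M (- T) = (\<Sum>\<sigma>\<in>set_pmf (label_pmf n \<rho>). pmf (label_pmf n \<rho>) \<sigma> *
        measure_pmf.prob (graph_pmf n P q \<sigma>) {G. real (card (swappable c \<sigma> G)) < K})"
      unfolding CSBM_eq qt[symmetric] by (simp add: prob_bind_pmf_finite[OF finite_set_label_pmf] vim)
    also have "\<dots> \<le> (\<Sum>\<sigma>\<in>set_pmf (label_pmf n \<rho>). pmf (label_pmf n \<rho>) \<sigma> *
        (indicator {\<sigma>. \<not> typical \<rho> m n \<eta> i \<sigma>} \<sigma> + \<beta>))"
      by (intro sum_mono mult_left_mono inner) auto
    also have "\<dots> = measure_pmf.expectation (label_pmf n \<rho>) (\<lambda>\<sigma>. indicator {\<sigma>. \<not> typical \<rho> m n \<eta> i \<sigma>} \<sigma> + \<beta>)"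
      by (simp add: expectation_finite_pmf finite_set_label_pmf)
    also have "\<dots> = measure_pmf.prob (label_pmf n \<rho>) {\<sigma>. \<not> typical \<rho> m n \<eta> i \<sigma>} + \<beta>"
      by (simp add: integrable_measure_pmf_finite[OF finite_set_label_pmf])
    finally show ?thesis .
  qed
  finally show ?thesis by (simp add: \<beta>_def)
qed

text \<open>\<open>\<Lambda>\<close> plays the role of \<open>ln n\<close>. Typicality turns vertex
  sums into \<open>n\<close> times averages over \<open>\<rho>\<close>: the drift average vanishes,
  the spread is small against the squared margin, and the prefactors yield the divergence.\<close>

lemma (in label_swap) prob_balanced_lower_typical:
  assumes \<rho>: "\<And>r. 0 < \<rho> $ r" "(\<Sum>r\<in>UNIV. \<rho> $ r) = 1"
    and \<sigma>: "typical \<rho> m n \<eta> i \<sigma>" and v: "v \<in> {1..m}" "\<sigma> v = i"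
    and n: "0 < n" and q': "q * real n = t * \<Lambda>" "q \<le> 1 / 2" and pos: "0 < t" "0 < \<Lambda>" "0 < \<epsilon>"
    and stationary: "(\<Sum>r\<in>UNIV. \<rho> $ r * label_drift r) = 0"
    and \<eta>: "t * \<eta> * (\<Sum>r\<in>UNIV. \<bar>label_drift r\<bar>) \<le> \<epsilon> / 2" "t * \<eta> * (\<Sum>r\<in>UNIV. \<bar>1 - label_affinity r\<bar>) \<le> \<epsilon>"
    and large: "8 * t * (\<Sum>r\<in>UNIV. label_spread r) \<le> \<epsilon>\<^sup>2 * \<Lambda>"
  shows "exp (- (t * (\<Sum>r\<in>UNIV. \<rho> $ r * (1 - label_affinity r)) + 2 * \<epsilon>) * \<Lambda> - 2 * t\<^sup>2 * \<Lambda>\<^sup>2 / real n) / 2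
    \<le> measure_pmf.prob (graph_pmf n P q \<sigma>) (balanced (\<epsilon> * \<Lambda>) \<sigma> v)"
proof -
  let ?S = "{m<..n}"
  let ?\<Delta> = "\<Sum>r\<in>UNIV. \<rho> $ r * (1 - label_affinity r)"
  have cnt: "\<bar>real (card {u \<in> ?S. \<sigma> u = r}) - \<rho> $ r * real n\<bar> \<le> \<eta> * real n" for r
    using \<sigma> by (simp add: typical_def[OF \<rho>])
  have A1: "label_affinity r \<le> 1" "0 < label_affinity r" for r unfolding label_affinity_def using affinity_le_1 affinity_pos P \<xi> by auto
  have V0: "0 \<le> label_spread r" for r
    unfolding label_spread_def spread_def using P
    by (intro add_nonneg_nonneg mult_nonneg_nonneg less_imp_le[OF geo_pos]) auto

  define d where "d = (\<Sum>u\<in>?S. q * label_drift (\<sigma> u))"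
  \<comment> \<open>The subtracted term is zero by stationarity; inserting it leaves only the
    fluctuation of the community counts.\<close>
  have "\<bar>d\<bar> = q * \<bar>(\<Sum>u\<in>?S. label_drift (\<sigma> u)) - real n * (\<Sum>r\<in>UNIV. \<rho> $ r * label_drift r)\<bar>"
    using q by (simp add: d_def stationary abs_mult flip: sum_distrib_left)
  also have "\<dots> \<le> q * (\<eta> * real n * (\<Sum>r\<in>UNIV. \<bar>label_drift r\<bar>))"
    by (intro mult_left_mono sum_over_labels_approx cnt q) auto
  also have "\<dots> = (t * \<eta> * (\<Sum>r\<in>UNIV. \<bar>label_drift r\<bar>)) * \<Lambda>"
    by (metis (no_types, lifting) q'(1) mult.assoc mult.commute)
  also have "\<dots> \<le> \<epsilon> / 2 * \<Lambda>" using \<eta> pos by (intro mult_right_mono) auto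
  finally have d: "\<bar>d\<bar> \<le> \<epsilon> * \<Lambda> / 2" by simp
  then have d': "\<bar>d\<bar> < \<epsilon> * \<Lambda>" using mult_pos_pos[OF pos(3,2)] by linarith

  have "(\<Sum>u\<in>?S. label_spread (\<sigma> u)) \<le> (\<Sum>u\<in>?S. \<Sum>r\<in>UNIV. label_spread r)"
    using V0 by (intro sum_mono member_le_sum) auto
  also have "\<dots> \<le> real n * (\<Sum>r\<in>UNIV. label_spread r)"
    using V0 by (auto intro!: mult_right_mono sum_nonneg)
  finally have "q * (\<Sum>u\<in>?S. label_spread (\<sigma> u)) \<le> q * (real n * (\<Sum>r\<in>UNIV. label_spread r))"
    using q by (intro mult_left_mono) auto
  also have "\<dots> = t * (\<Sum>r\<in>UNIV. label_spread r) * \<Lambda>" by (metis (no_types, lifting) q'(1) mult.assoc mult.commute)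
  also have "\<dots> \<le> \<epsilon>\<^sup>2 * \<Lambda> / 8 * \<Lambda>" using large pos by (intro mult_right_mono) auto
  finally have sV: "(\<Sum>u\<in>?S. q * label_spread (\<sigma> u)) \<le> (\<epsilon> * \<Lambda> / 2)\<^sup>2 / 2"
    by (simp add: power2_eq_square mult_ac flip: sum_distrib_left)
  have "(\<Sum>u\<in>?S. q * label_spread (\<sigma> u)) / (\<epsilon> * \<Lambda> - \<bar>d\<bar>)\<^sup>2 \<le> ((\<epsilon> * \<Lambda> / 2)\<^sup>2 / 2) / (\<epsilon> * \<Lambda> / 2)\<^sup>2"
  proof (intro frac_le power_mono)
    show "\<epsilon> * \<Lambda> / 2 \<le> \<epsilon> * \<Lambda> - \<bar>d\<bar>" using d by linarith
    show "0 < (\<epsilon> * \<Lambda> / 2)\<^sup>2" using pos by simp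
  qed (use sV pos in auto)
  also have "\<dots> = 1 / 2" using pos by simp
  finally have half: "1 / 2 \<le> 1 - (\<Sum>u\<in>?S. q * label_spread (\<sigma> u)) / (\<epsilon> * \<Lambda> - \<bar>d\<bar>)\<^sup>2" by simp

  have "(\<Sum>u\<in>?S. 1 - label_affinity (\<sigma> u)) \<le> real n * ?\<Delta> + \<eta> * real n * (\<Sum>r\<in>UNIV. \<bar>1 - label_affinity r\<bar>)"
    using sum_over_labels_approx[of ?S \<sigma> \<rho> "real n" \<eta> "\<lambda>r. 1 - label_affinity r", OF _ cnt] by (simp add: abs_le_iff)
  then have "q * (\<Sum>u\<in>?S. 1 - label_affinity (\<sigma> u)) \<le> q * (real n * ?\<Delta> + \<eta> * real n * (\<Sum>r\<in>UNIV. \<bar>1 - label_affinity r\<bar>))"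
    using q by (intro mult_left_mono) auto
  also have "\<dots> = q * real n * ?\<Delta> + q * real n * (\<eta> * (\<Sum>r\<in>UNIV. \<bar>1 - label_affinity r\<bar>))"
    by (simp only: distrib_left mult_ac)
  also have "\<dots> = t * \<Lambda> * ?\<Delta> + t * \<eta> * (\<Sum>r\<in>UNIV. \<bar>1 - label_affinity r\<bar>) * \<Lambda>"
    unfolding q'(1) by (simp only: mult_ac)
  also have "\<dots> \<le> t * \<Lambda> * ?\<Delta> + \<epsilon> * \<Lambda>"
    using \<eta> pos by (intro add_left_mono mult_right_mono) auto
  finally have e1: "q * (\<Sum>u\<in>?S. 1 - label_affinity (\<sigma> u)) \<le> t * \<Lambda> * ?\<Delta> + \<epsilon> * \<Lambda>" .
  have "real (card ?S) * (2 * q\<^sup>2) \<le> real n * (2 * q\<^sup>2)"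
    by (intro mult_right_mono) auto
  also have "\<dots> = 2 * (q * real n)\<^sup>2 / real n" using n by (simp add: power2_eq_square)
  finally have e2: "real (card ?S) * (2 * q\<^sup>2) \<le> 2 * t\<^sup>2 * \<Lambda>\<^sup>2 / real n"
    by (simp add: q'(1) power_mult_distrib)
  \<comment> \<open>Combines \<open>1 - q \<ge> exp (- q - 2 * q\<^sup>2)\<close>, valid for
    \<open>q \<le> 1 / 2\<close>, with \<open>1 - x \<le> exp (- x)\<close> for the denominator. The
    quadratic errors add up to the bound \<open>e2\<close>.\<close>
  have factor: "exp (- (q * (1 - label_affinity r)) - 2 * q\<^sup>2) \<le> (1 - q) / (1 - q * label_affinity r)" for r
  proof -
    have "exp (- q - 2 * q\<^sup>2) \<le> 1 - q"
      using ln_one_minus_pos_lower_bound[of q] q q' by (simp add: ln_ge_iff)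
    moreover have "1 - q * label_affinity r \<le> exp (- (q * label_affinity r))" using exp_ge_add_one_self[of "- (q * label_affinity r)"] by simp
    moreover have "0 < 1 - q * label_affinity r" using q A1[of r] mult_left_le[of "label_affinity r" q] by simp
    ultimately have "exp (- q - 2 * q\<^sup>2) / exp (- (q * label_affinity r)) \<le> (1 - q) / (1 - q * label_affinity r)"
      using q by (intro frac_le) auto
    then show ?thesis by (simp add: algebra_simps flip: exp_diff)
  qed
  have "exp (- (t * \<Lambda> * ?\<Delta> + \<epsilon> * \<Lambda>) - 2 * t\<^sup>2 * \<Lambda>\<^sup>2 / real n)
      \<le> exp (\<Sum>u\<in>?S. - (q * (1 - label_affinity (\<sigma> u))) - 2 * q\<^sup>2)"
    using e1 e2 by (simp add: sum_subtractf sum_negf flip: sum_distrib_left)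
  also have "\<dots> = (\<Prod>u\<in>?S. exp (- (q * (1 - label_affinity (\<sigma> u))) - 2 * q\<^sup>2))" by (simp add: exp_sum)
  also have "\<dots> \<le> (\<Prod>u\<in>?S. (1 - q) / (1 - q * label_affinity (\<sigma> u)))"
    by (intro prod_mono) (simp add: factor)
  finally have prod: "exp (- (t * \<Lambda> * ?\<Delta> + \<epsilon> * \<Lambda>) - 2 * t\<^sup>2 * \<Lambda>\<^sup>2 / real n)
      \<le> (\<Prod>u\<in>?S. (1 - q) / (1 - q * label_affinity (\<sigma> u)))" .
  \<comment> \<open>One \<open>\<epsilon>\<close> pays for the fluctuation of the affinities, the
    other for the factor \<open>exp (- c)\<close>; the final half is the Chebyshev bound.\<close>
  have "exp (- (t * ?\<Delta> + 2 * \<epsilon>) * \<Lambda> - 2 * t\<^sup>2 * \<Lambda>\<^sup>2 / real n) / 2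
      = exp (- (t * \<Lambda> * ?\<Delta> + \<epsilon> * \<Lambda>) - 2 * t\<^sup>2 * \<Lambda>\<^sup>2 / real n) * exp (- (\<epsilon> * \<Lambda>)) * (1 / 2)"
    by (simp add: algebra_simps flip: exp_add)
  also have "\<dots> \<le> (\<Prod>u\<in>?S. (1 - q) / (1 - q * label_affinity (\<sigma> u))) * exp (- (\<epsilon> * \<Lambda>))
      * (1 - (\<Sum>u\<in>?S. q * label_spread (\<sigma> u)) / (\<epsilon> * \<Lambda> - \<bar>d\<bar>)\<^sup>2)"
    using prod half by (intro mult_mono) (auto intro!: mult_nonneg_nonneg order_trans[OF exp_ge_zero prod])
  also have "\<dots> \<le> measure_pmf.prob (graph_pmf n P q \<sigma>) (balanced (\<epsilon> * \<Lambda>) \<sigma> v)"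
    unfolding d_def by (rule prob_balanced_lower[of v \<sigma>, OF v]) (use d' pos in \<open>auto simp: d_def[symmetric]\<close>)
  finally show ?thesis .
qed

subsection \<open>The Chernoff-Hellinger divergence\<close>

text \<open>The linear terms of the edge and non-edge coordinates of \<open>r\<close> add up to
  \<open>\<rho> $ r\<close>, and the geometric mean is homogeneous of degree one. Symmetry of
  \<open>P\<close> reconciles the column indexing in \<open>\<theta>\<close> with row
  indexing.\<close>

lemma CH_eq_affinity:
  assumes "\<And>r. 0 < \<rho> $ r" "\<And>r s. 0 < P $ r $ s" "\<And>r s. P $ r $ s < 1" "\<And>r s. P $ r $ s = P $ s $ r"
    and "(\<Sum>r\<in>UNIV. \<rho> $ r) = 1"
  shows "CH \<xi> (\<theta> \<rho> P i) (\<theta> \<rho> P j) = (\<Sum>r\<in>UNIV. \<rho> $ r * (1 - affinity \<xi> (P $ i $ r) (P $ j $ r)))"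
proof -
  have geo_scale: "(\<rho> $ r * a) powr \<xi> * (\<rho> $ r * b) powr (1 - \<xi>) = \<rho> $ r * geo \<xi> a b"
    if "0 < a" "0 < b" for r a b
  proof -
    have "\<rho> $ r powr \<xi> * \<rho> $ r powr (1 - \<xi>) = \<rho> $ r"
      using assms(1)[of r] by (simp flip: powr_add)
    then show ?thesis
      using assms(1)[of r] that by (simp add: powr_mult geo_def mult_ac)
  qed
  have "CH \<xi> (\<theta> \<rho> P i) (\<theta> \<rho> P j) = (\<Sum>r\<in>UNIV. \<Sum>e\<in>UNIV.
      \<xi> * \<theta> \<rho> P i $ (r, e) + (1 - \<xi>) * \<theta> \<rho> P j $ (r, e)
      - (\<theta> \<rho> P i $ (r, e)) powr \<xi> * (\<theta> \<rho> P j $ (r, e)) powr (1 - \<xi>))"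
    unfolding CH_def by (simp add: sum.cartesian_product case_prod_unfold flip: UNIV_Times_UNIV)
  also have "\<dots> = (\<Sum>r\<in>UNIV. \<rho> $ r * (1 - affinity \<xi> (P $ i $ r) (P $ j $ r)))"
  proof (intro sum.cong refl)
    fix r
    show "(\<Sum>e\<in>UNIV. \<xi> * \<theta> \<rho> P i $ (r, e) + (1 - \<xi>) * \<theta> \<rho> P j $ (r, e)
      - (\<theta> \<rho> P i $ (r, e)) powr \<xi> * (\<theta> \<rho> P j $ (r, e)) powr (1 - \<xi>))
      = \<rho> $ r * (1 - affinity \<xi> (P $ i $ r) (P $ j $ r))"
      using assms by (simp add: UNIV_bool \<theta>_def geo_scale affinity_def assms(4)[of r]) (simp add: algebra_simps)
  qed
  finally show ?thesis .
qed

lemma affinity_boundary: "0 < a \<Longrightarrow> a < 1 \<Longrightarrow> 0 < b \<Longrightarrow> b < 1 \<Longrightarrow> affinity 0 a b = 1 \<and> affinity 1 a b = 1"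
  by (simp add: affinity_def geo_def)

text \<open>This makes a critical point of the Chernoff-Hellinger function the same as a vanishing
  average drift.\<close>

lemma has_real_derivative_affinity:
  assumes "0 < a" "a < 1" "0 < b" "b < 1"
  shows "((\<lambda>\<xi>. affinity \<xi> a b) has_real_derivative - drift \<xi> a b) (at \<xi>)"
proof -
  have "((\<lambda>\<xi>. geo \<xi> x y) has_real_derivative - (geo \<xi> x y * ln (y / x))) (at \<xi>)"
    if "0 < x" "0 < y" for x y
    unfolding geo_def using that
    by (auto intro!: derivative_eq_intros simp: ln_div algebra_simps)
  from this[of a b] this[of "1 - a" "1 - b"] show ?thesis
    unfolding affinity_def drift_def using assms by (auto intro!: derivative_eq_intros)
qed

text \<open>The function vanishes at both endpoints and is nonnegative inside. A maximum at an
  endpoint therefore has value 0 and is also attained at \<open>1 / 2\<close>; at an interior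
  maximum the derivative is zero.\<close>

lemma exists_interior_stationary:
  fixes \<rho> :: "real ^ 'k::finite"
  assumes \<rho>: "\<And>r. 0 < \<rho> $ r" "(\<Sum>r\<in>UNIV. \<rho> $ r) = 1"
    and P: "\<And>r s. 0 < P $ r $ s" "\<And>r s. P $ r $ s < 1" "\<And>r s. P $ r $ s = P $ s $ r"
  shows "\<exists>\<xi>. 0 < \<xi> \<and> \<xi> < 1
    \<and> CH_divergence (\<theta> \<rho> P i) (\<theta> \<rho> P j) = (\<Sum>r\<in>UNIV. \<rho> $ r * (1 - affinity \<xi> (P $ i $ r) (P $ j $ r)))
    \<and> (\<Sum>r\<in>UNIV. \<rho> $ r * drift \<xi> (P $ i $ r) (P $ j $ r)) = 0"
proof -
  define f where "f = (\<lambda>\<xi>. \<Sum>r\<in>UNIV. \<rho> $ r * (1 - affinity \<xi> (P $ i $ r) (P $ j $ r)))"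
  have f: "CH \<xi> (\<theta> \<rho> P i) (\<theta> \<rho> P j) = f \<xi>" for \<xi>
    unfolding f_def by (rule CH_eq_affinity) (use \<rho> P in auto)
  have "0 < \<theta> \<rho> P i $ e" for i e
    using \<rho> P by (cases e) (auto simp: \<theta>_def)
  then obtain \<xi>\<^sub>0 where \<xi>\<^sub>0: "\<xi>\<^sub>0 \<in> {0..1}" "CH_divergence (\<theta> \<rho> P i) (\<theta> \<rho> P j) = f \<xi>\<^sub>0"
      "\<And>\<zeta>. \<zeta> \<in> {0..1} \<Longrightarrow> f \<zeta> \<le> f \<xi>\<^sub>0"
    using CH_divergence_attained[of "\<theta> \<rho> P i" "\<theta> \<rho> P j"] by (auto simp: f)
  obtain \<xi> where \<xi>: "0 < \<xi>" "\<xi> < 1" "f \<xi> = f \<xi>\<^sub>0"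
  proof (cases "\<xi>\<^sub>0 \<in> {0<..<1}")
    case False
    then have "\<xi>\<^sub>0 = 0 \<or> \<xi>\<^sub>0 = 1" using \<xi>\<^sub>0 by auto
    then have "f \<xi>\<^sub>0 = 0" using affinity_boundary P by (auto simp: f_def)
    moreover have "0 \<le> f (1 / 2)"
      unfolding f_def using \<rho> P by (intro sum_nonneg mult_nonneg_nonneg) (auto intro: less_imp_le affinity_le_1)
    moreover have "f (1 / 2) \<le> f \<xi>\<^sub>0" by (rule \<xi>\<^sub>0) auto
    ultimately show ?thesis using that[of "1 / 2"] by simp
  qed (use that[of \<xi>\<^sub>0] in auto)
  have "(f has_real_derivative (\<Sum>r\<in>UNIV. \<rho> $ r * drift \<xi> (P $ i $ r) (P $ j $ r))) (at \<xi>)"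
    unfolding f_def
    by (auto intro!: derivative_eq_intros has_real_derivative_affinity P sum.cong)
  moreover have "\<forall>y. \<bar>\<xi> - y\<bar> < min \<xi> (1 - \<xi>) \<longrightarrow> f y \<le> f \<xi>"
    using \<xi> \<xi>\<^sub>0(3) by (auto simp: abs_if split: if_splits)
  ultimately have "(\<Sum>r\<in>UNIV. \<rho> $ r * drift \<xi> (P $ i $ r) (P $ j $ r)) = 0"
    using \<xi> by (intro DERIV_local_max[of f _ \<xi> "min \<xi> (1 - \<xi>)"]) auto
  then show ?thesis using \<xi> \<xi>\<^sub>0(2) by (auto simp: f_def)
qed

lemma less_t_crit_imp:
  fixes \<rho> :: "real ^ 'k::finite"
  assumes "CARD('k) \<ge> 2" "ereal t < t_crit \<rho> P"
    and nonneg: "\<And>i j. 0 \<le> CH_divergence (\<theta> \<rho> P i) (\<theta> \<rho> P j)"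
  shows "\<exists>i j. i \<noteq> j \<and> t * CH_divergence (\<theta> \<rho> P i) (\<theta> \<rho> P j) < 1"
proof -
  let ?X = "{CH_divergence (\<theta> \<rho> P i) (\<theta> \<rho> P j) | i j. i \<noteq> j}"
  have "?X \<subseteq> (\<lambda>(i, j). CH_divergence (\<theta> \<rho> P i) (\<theta> \<rho> P j)) ` UNIV" by auto
  then have fin: "finite ?X" by (rule finite_subset) auto
  obtain a b :: 'k where "a \<noteq> b"
    using assms(1) by (metis (full_types) UNIV_I card_2_iff' card_le_Suc0_iff_eq finite not_less_eq_eq numeral_2_eq_2)
  then have "?X \<noteq> {}" by blast
  then have "Min ?X \<in> ?X" using fin by (intro Min_in)
  then obtain i j where ij: "i \<noteq> j" "Min ?X = CH_divergence (\<theta> \<rho> P i) (\<theta> \<rho> P j)" by blast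
  define \<Delta> where "\<Delta> = CH_divergence (\<theta> \<rho> P i) (\<theta> \<rho> P j)"
  have "t * \<Delta> < 1"
  \<comment> \<open>For \<open>\<Delta> = 0\<close> the threshold is infinite and the claim is
    trivial; otherwise the inverse is that of a positive real.\<close>
  proof (cases "\<Delta> = 0")
    case False
    then have "\<Delta> > 0" using nonneg[of i j] by (simp add: \<Delta>_def)
    moreover have "ereal t < inverse (ereal \<Delta>)" using assms(2) ij by (simp add: t_crit_def \<Delta>_def)
    ultimately have "t < inverse \<Delta>" by simp
    then show ?thesis using \<open>\<Delta> > 0\<close> by (simp add: field_simps)
  qed auto
  then show ?thesis using ij by (auto simp: \<Delta>_def)
qed

subsection \<open>Asymptotics\<close>

text \<open>The square of the logarithm makes \<open>m * q\<close> vanish, while the block loses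
  only a polylogarithmic factor against \<open>n\<close>.\<close>

definition block_size :: "nat \<Rightarrow> nat" where
  "block_size n = nat \<lfloor>real n / (ln (real n))\<^sup>2\<rfloor>"

lemma block_size_at_top: "filterlim (\<lambda>n. real (block_size n)) at_top at_top"
  unfolding block_size_def by real_asymp

lemma block_size_over_n: "(\<lambda>n. real (block_size n) / real n) \<longlonglongrightarrow> 0"
  unfolding block_size_def by real_asymp

lemma block_size_times_log: "(\<lambda>n. real (block_size n) * (t * ln (real n) / real n)) \<longlonglongrightarrow> 0"
proof -
  have "(\<lambda>n. real (block_size n) * (ln (real n) / real n)) \<longlonglongrightarrow> 0"
    unfolding block_size_def by real_asymp
  from tendsto_mult_left[OF this, of t] show ?thesis by (simp add: mult_ac)
qed

text \<open>The growth is that of \<open>n powr (1 - a)\<close> over a squared logarithm: rounding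
  costs at most 1 and the quadratic correction in the exponent tends to 0.\<close>

lemma block_size_exp_at_top:
  fixes a t :: real
  assumes "a < 1"
  shows "filterlim (\<lambda>n. real (block_size n) * exp (- a * ln (real n) - 2 * t\<^sup>2 * (ln (real n))\<^sup>2 / real n)) at_top at_top"
proof -
  define b where "b = 1 - a"
  have "b > 0" using assms by (simp add: b_def)
  have "filterlim (\<lambda>n. (real n / (ln (real n))\<^sup>2 - 1) * exp (- (1 - b) * ln (real n) - 2 * t\<^sup>2 * (ln (real n))\<^sup>2 / real n)) at_top at_top"
    using \<open>b > 0\<close> by real_asymp
  then show ?thesis
  proof (rule filterlim_at_top_mono)
    show "\<forall>\<^sub>F n in sequentially. (real n / (ln (real n))\<^sup>2 - 1) * exp (- (1 - b) * ln (real n) - 2 * t\<^sup>2 * (ln (real n))\<^sup>2 / real n)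
      \<le> real (block_size n) * exp (- a * ln (real n) - 2 * t\<^sup>2 * (ln (real n))\<^sup>2 / real n)"
    proof (intro always_eventually allI)
      fix n
      have "real n / (ln (real n))\<^sup>2 - 1 \<le> real (block_size n)"
        unfolding block_size_def by linarith
      then show "(real n / (ln (real n))\<^sup>2 - 1) * exp (- (1 - b) * ln (real n) - 2 * t\<^sup>2 * (ln (real n))\<^sup>2 / real n)
        \<le> real (block_size n) * exp (- a * ln (real n) - 2 * t\<^sup>2 * (ln (real n))\<^sup>2 / real n)"
        by (simp add: b_def mult_right_mono)
    qed
  qed
qed

theorem theorem1p4:
  fixes \<rho> :: "real ^ 'k::finite"
    and P :: "real ^ 'k ^ 'k"
    and t :: real
    and est :: "nat \<Rightarrow> 'k estimator"
  assumes "CARD('k) \<ge> 2"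
    and "\<And>i. 0 < \<rho> $ i \<and> \<rho> $ i < 1"
    and "(\<Sum>i\<in>UNIV. \<rho> $ i) = 1"
    and "\<And>i j. 0 < P $ i $ j \<and> P $ i $ j < 1"
    and "transpose P = P"
    and "t > 0"
    and "ereal t < t_crit \<rho> P"
  shows "(\<lambda>n. measure_pmf.prob (truth_estimate_pmf (CSBM n \<rho> P t) (est n))
            {(\<sigma>\<^sub>0, \<sigma>). exact_recovery n \<sigma>\<^sub>0 \<sigma>}) \<longlonglongrightarrow> 0"
proof -
  have \<rho>: "\<And>r. 0 < \<rho> $ r" "(\<Sum>r\<in>UNIV. \<rho> $ r) = 1" using assms by auto
  have P: "\<And>r s. 0 < P $ r $ s" "\<And>r s. P $ r $ s < 1" using assms by auto
  have sym: "P $ r $ s = P $ s $ r" for r s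
    using assms(5) by (metis (no_types, lifting) transpose_def vec_lambda_beta)
  note stationary = exists_interior_stationary[OF \<rho> P sym]
  have "0 \<le> CH_divergence (\<theta> \<rho> P i) (\<theta> \<rho> P j)" for i j
  proof -
    obtain \<xi> where "0 < \<xi>" "\<xi> < 1" "CH_divergence (\<theta> \<rho> P i) (\<theta> \<rho> P j)
        = (\<Sum>r\<in>UNIV. \<rho> $ r * (1 - affinity \<xi> (P $ i $ r) (P $ j $ r)))"
      using stationary by blast
    then show ?thesis using \<rho> P
      by (auto intro!: sum_nonneg mult_nonneg_nonneg less_imp_le[of 0 "\<rho> $ _"] affinity_le_1)
  qed
  from less_t_crit_imp[OF assms(1,7) this] obtain i j
    where ij: "i \<noteq> j" and sub: "t * CH_divergence (\<theta> \<rho> P i) (\<theta> \<rho> P j) < 1" by blast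
  obtain \<xi> where \<xi>: "0 < \<xi>" "\<xi> < 1"
    and \<Delta>: "CH_divergence (\<theta> \<rho> P i) (\<theta> \<rho> P j) = (\<Sum>r\<in>UNIV. \<rho> $ r * (1 - affinity \<xi> (P $ i $ r) (P $ j $ r)))"
    and D0: "(\<Sum>r\<in>UNIV. \<rho> $ r * drift \<xi> (P $ i $ r) (P $ j $ r)) = 0"
    using stationary[of i j] by blast
  define \<Delta> where "\<Delta> = CH_divergence (\<theta> \<rho> P i) (\<theta> \<rho> P j)"
  \<comment> \<open>The lower bound \<open>p\<close> loses \<open>2 * \<epsilon>\<close> in the
    exponent and \<open>exp (- c)\<close> loses another \<open>\<epsilon>\<close>; a quarter of the
    gap accommodates all three.\<close>
  define \<epsilon> where "\<epsilon> = (1 - t * \<Delta>) / 4"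
  have quarter: "0 < (1 - x) / 4 \<and> x + 3 * ((1 - x) / 4) < 1" if "x < 1" for x :: real
    using that by (simp add: field_simps)
  have \<epsilon>: "0 < \<epsilon>" "t * \<Delta> + 3 * \<epsilon> < 1"
    using quarter[OF sub] by (simp_all add: \<epsilon>_def \<Delta>_def)
  define sD where "sD = (\<Sum>r\<in>UNIV. \<bar>drift \<xi> (P $ i $ r) (P $ j $ r)\<bar>)"
  define sA where "sA = (\<Sum>r\<in>UNIV. \<bar>1 - affinity \<xi> (P $ i $ r) (P $ j $ r)\<bar>)"
  define sV where "sV = (\<Sum>r\<in>UNIV. spread \<xi> (P $ i $ r) (P $ j $ r))"
  have s0: "0 \<le> sD" "0 \<le> sA" by (auto simp: sD_def sA_def intro: sum_nonneg)
  \<comment> \<open>Small enough for both fluctuation hypotheses of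
    \<open>prob_balanced_lower_typical\<close>; the added 1 keeps the denominator positive.\<close>
  define \<eta> where "\<eta> = \<epsilon> / (2 * t * (sD + sA + 1))"
  have \<eta>: "0 < \<eta>" "t * \<eta> * sD \<le> \<epsilon> / 2" "t * \<eta> * sA \<le> \<epsilon>"
  proof -
    have t\<eta>: "t * \<eta> * s = \<epsilon> / 2 * (s / (sD + sA + 1))" for s
      using \<open>t > 0\<close> by (simp add: \<eta>_def)
    have "0 \<le> sD / (sD + sA + 1)" "sD / (sD + sA + 1) \<le> 1" "0 \<le> sA / (sD + sA + 1)" "sA / (sD + sA + 1) \<le> 1"
      using s0 by auto
    then have "t * \<eta> * sD \<le> \<epsilon> / 2" "t * \<eta> * sA \<le> \<epsilon> / 2"
      unfolding t\<eta> using \<epsilon> less_imp_le[OF half_gt_zero[OF \<epsilon>(1)]] by (blast intro: mult_left_le)+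
    then show "t * \<eta> * sD \<le> \<epsilon> / 2" "t * \<eta> * sA \<le> \<epsilon>" using \<epsilon> by linarith+
    show "0 < \<eta>" using s0 \<epsilon> \<open>t > 0\<close> by (auto simp: \<eta>_def intro!: divide_pos_pos mult_pos_pos)
  qed

  define p where "p = (\<lambda>n. exp (- (t * \<Delta> + 2 * \<epsilon>) * ln (real n) - 2 * t\<^sup>2 * (ln (real n))\<^sup>2 / real n) / 2)"
  define c where "c = (\<lambda>n. \<epsilon> * ln (real n))"
  define q where "q = (\<lambda>n. t * ln (real n) / real n)"
  define m where "m = block_size"
  define N where "N = real (card (UNIV :: ('k \<Rightarrow> 'k) set))"
  define bound where "bound = (\<lambda>n.
     (real CARD('k) * (real n / (\<eta> * real n - real (m n))\<^sup>2) + 4 / ((\<rho> $ i)\<^sup>2 * real (m n)))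
      + 8 / (\<rho> $ i * real (m n) * p n) + 4 * (real (m n) * q n)
      + 8 * N / (\<rho> $ j * (real (m n) * p n * exp (- c n))))"

  have ev_m: "\<forall>\<^sub>F n in sequentially. real (m n) \<ge> 1"
    using block_size_at_top unfolding m_def filterlim_at_top by blast
  \<comment> \<open>The bound 1 gives \<open>m n \<le> n\<close>, and \<open>\<eta> / 2\<close>
    keeps \<open>\<eta> * real n - real (m n)\<close> of order \<open>n\<close>.\<close>
  have ev_mn: "\<forall>\<^sub>F n in sequentially. real (m n) / real n < min 1 (\<eta> / 2)"
    using order_tendstoD(2)[OF block_size_over_n, of "min 1 (\<eta> / 2)"] \<eta> by (simp add: m_def)
  have "q \<longlonglongrightarrow> 0" using \<open>t > 0\<close> unfolding q_def by real_asymp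
  then have ev_q: "\<forall>\<^sub>F n in sequentially. q n < 1 / 2" by (rule order_tendstoD) simp
  have "filterlim (\<lambda>n. ln (real n)) at_top at_top" by real_asymp
  \<comment> \<open>The 1 makes the logarithm positive; the other term makes the spread negligible
    in the Chebyshev step.\<close>
  then have ev_ln: "\<forall>\<^sub>F n in sequentially. ln (real n) \<ge> max 1 (8 * t * sV / \<epsilon>\<^sup>2)"
    unfolding filterlim_at_top by blast

  have upper: "\<forall>\<^sub>F n in sequentially. measure_pmf.prob (truth_estimate_pmf (CSBM n \<rho> P t) (est n))
            {(\<sigma>\<^sub>0, \<sigma>). exact_recovery n \<sigma>\<^sub>0 \<sigma>} \<le> bound n"
    using ev_m ev_mn ev_q ev_ln eventually_gt_at_top[of 0]
  proof eventually_elim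
    case (elim n)
    have size: "m n \<le> n" "real (m n) < \<eta> * real n" "0 < m n"
      using elim \<eta> by (auto simp: field_simps)
    interpret label_swap P i j \<xi> "q n" "m n" n
      using P \<xi> ij size elim \<open>t > 0\<close> by unfold_locales (auto simp: q_def)
    have label_quantities: "label_affinity r = affinity \<xi> (P $ i $ r) (P $ j $ r)" "label_drift r = drift \<xi> (P $ i $ r) (P $ j $ r)"
      "label_spread r = spread \<xi> (P $ i $ r) (P $ j $ r)" for r
      by (simp_all add: label_affinity_def label_drift_def label_spread_def)
    have "8 * t * sV \<le> \<epsilon>\<^sup>2 * ln (real n)"
      using elim \<epsilon> by (simp add: field_simps)
    then have lower: "p n \<le> measure_pmf.prob (graph_pmf n P (q n) \<sigma>) (balanced (c n) \<sigma> v)"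
      if "typical \<rho> (m n) n \<eta> i \<sigma>" "v \<in> {1..m n}" "\<sigma> v = i" for \<sigma> v
      using prob_balanced_lower_typical[OF \<rho> that, of t "ln (real n)" \<epsilon>] elim \<epsilon> \<eta> D0 \<open>t > 0\<close>
      by (simp add: label_quantities c_def p_def \<Delta>_def \<Delta> sD_def sA_def sV_def q_def)
    have "p n > 0" by (simp add: p_def)
    have "measure_pmf.prob (truth_estimate_pmf (CSBM n \<rho> P t) (est n)) {(\<sigma>\<^sub>0, \<sigma>). exact_recovery n \<sigma>\<^sub>0 \<sigma>}
      \<le> measure_pmf.prob (label_pmf n \<rho>) {\<sigma>. \<not> typical \<rho> (m n) n \<eta> i \<sigma>}
      + 8 / (\<rho> $ i * real (m n) * p n) + 4 * (real (m n) * q n)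
      + 8 * N / (\<rho> $ j * (real (m n) * p n * exp (- c n)))"
      unfolding N_def
      by (rule prob_exact_recovery_le[OF \<rho> _ \<open>p n > 0\<close> size(3) lower]) (auto simp: q_def)
    also have "\<dots> \<le> bound n"
      unfolding bound_def using prob_not_typical_le[OF \<rho> size(3,1,2)] by (intro add_right_mono)
    finally show ?case .
  qed

  \<comment> \<open>The growth of this product makes the posterior term vanish; it is where the full
    \<open>3 * \<epsilon>\<close> is spent.\<close>
  have mp: "filterlim (\<lambda>n. real (m n) * p n * exp (- c n)) at_top at_top"
  proof -
    have eq: "real (m n) * p n * exp (- c n) = 1 / 2 * (real (block_size n)
      * exp (- (t * \<Delta> + 3 * \<epsilon>) * ln (real n) - 2 * t\<^sup>2 * (ln (real n))\<^sup>2 / real n))" for n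
      by (simp add: m_def p_def c_def algebra_simps flip: exp_add)
    show ?thesis
      unfolding eq
      by (rule filterlim_tendsto_pos_mult_at_top[OF tendsto_const _ block_size_exp_at_top[OF \<epsilon>(2)]]) simp
  qed
  have mp': "filterlim (\<lambda>n. real (m n) * p n) at_top at_top"
  proof -
    have "t * \<Delta> + 2 * \<epsilon> < 1" using \<epsilon> by simp
    from filterlim_tendsto_pos_mult_at_top[OF tendsto_const _ block_size_exp_at_top[OF this, of t], of "1 / 2"]
    show ?thesis by (simp add: m_def p_def)
  qed
  have inv: "(\<lambda>n. C / (d * f n)) \<longlonglongrightarrow> 0" if "filterlim f at_top at_top" "0 < d" for C d :: real and f :: "nat \<Rightarrow> real"
    by (rule tendsto_divide_0[OF tendsto_const filterlim_at_top_imp_at_infinity])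
       (rule filterlim_tendsto_pos_mult_at_top[OF tendsto_const that(2,1)])
  have conc: "(\<lambda>n. real n / (\<eta> * real n - real (m n))\<^sup>2) \<longlonglongrightarrow> 0"
  proof (rule tendsto_sandwich[OF _ _ tendsto_const])
    show "\<forall>\<^sub>F n in sequentially. 0 \<le> real n / (\<eta> * real n - real (m n))\<^sup>2" by simp
    show "\<forall>\<^sub>F n in sequentially. real n / (\<eta> * real n - real (m n))\<^sup>2 \<le> 4 / (\<eta>\<^sup>2 * real n)"
      using ev_mn eventually_gt_at_top[of 0]
    proof eventually_elim
      case (elim n)
      have "\<eta> / 2 * real n \<le> \<eta> * real n - real (m n)" using elim by (simp add: field_simps)
      then have "real n / (\<eta> * real n - real (m n))\<^sup>2 \<le> real n / (\<eta> / 2 * real n)\<^sup>2"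
        using elim \<eta> by (intro frac_le power_mono) (auto simp: zero_less_power)
      also have "\<dots> = 4 / (\<eta>\<^sup>2 * real n)" using elim by (simp add: power2_eq_square)
      finally show ?case .
    qed
    show "(\<lambda>n. 4 / (\<eta>\<^sup>2 * real n)) \<longlonglongrightarrow> 0" using \<eta> by (intro inv filterlim_real_sequentially) auto
  qed
  have "bound \<longlonglongrightarrow> real CARD('k) * 0 + 0 + 0 + 4 * 0 + 0"
    unfolding bound_def
  proof (intro tendsto_add tendsto_mult[OF tendsto_const] conc)
    show "(\<lambda>n. 4 / ((\<rho> $ i)\<^sup>2 * real (m n))) \<longlonglongrightarrow> 0"
      unfolding m_def using \<rho>(1)[of i] by (intro inv block_size_at_top) auto
    show "(\<lambda>n. 8 / (\<rho> $ i * real (m n) * p n)) \<longlonglongrightarrow> 0"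
      unfolding mult.assoc using \<rho>(1)[of i] by (intro inv mp')
    show "(\<lambda>n. real (m n) * q n) \<longlonglongrightarrow> 0"
      unfolding m_def q_def by (rule block_size_times_log)
    show "(\<lambda>n. 8 * N / (\<rho> $ j * (real (m n) * p n * exp (- c n)))) \<longlonglongrightarrow> 0"
      by (intro inv mp \<rho>)
  qed
  then have "bound \<longlonglongrightarrow> 0" by simp
  from tendsto_sandwich[OF _ upper tendsto_const this] show ?thesis by simp
qed

end
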